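(* Let $0<q<1$ and let $l$ be an odd positive integer. The right $\mathcal{O}(U(1))$-comodule algebra $\mathcal{O}(\Sigma_q^3(l,+))$ (with coaction $\Omega$) is trivial, i.e. it is a trivial principal comodule algebra.
   Context: All algebras are unital associative $*$-algebras over $\mathbb{C}$. $\mathcal{O}(U(1))=\mathbb{C}[u,u^*]$ is the Hopf $*$-algebra of Laurent polynomials in a unitary variable $u$ ($u^{-1}=u^*$) with $\Delta(u)=u\otimes u$, $\varepsilon(u)=1$, $S(u)=u^*$. $\mathcal{O}(\Sigma_q^3(l,+))$ is the $*$-algebra generated by $x',y'$ and a central unitary $z'$ subject to $x'y'=q^{2l}y'x'$, $x'y'^*=q^{2l}y'^*x'$, $y'y'^*=y'^*y'$, $y'^*=y'z'^2$, $x'x'^*=\prod_{p=0}^{l-1}(1-q^{2p}y'z')$, $x'^*x'=\prod_{p=1}^{l}(1-q^{-2p}y'z')$. It is a right $\mathcal{O}(U(1))$-comodule algebra via the $*$-algebra map $\Omega:\mathcal{O}(\Sigma_q^3(l,+))\to\mathcal{O}(\Sigma_q^3(l,+))\otimes\mathcal{O}(U(1))$, $x'\mapsto x'\otimes u$, $y'\mapsto y'\otimes u$, $z'\mapsto z'\otimes u^{-1}$. For a Hopf algebra $H$ (with bijective antipode), a right $H$-comodule algebra $A$ is called trivial (a trivial principal comodule algebra) if there exists a right $H$-colinear algebra map $j:H\to A$ (where $H$ coacts on itself by $\Delta$). *)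

theory Defs
  imports Complex_Main "HOL-Library.Poly_Mapping" "HOL-Algebra.QuotRing"
    "HOL-Algebra.Module" "HOL-Algebra.Elementary_Groups"
begin

section \<open>Complex *-algebras\<close>

text \<open>
  Algebras are records with an explicit carrier.  The locale \<^locale>\<open>algebra\<close> of HOL-Algebra
  covers commutative algebras only, so the noncommutative axioms are stated here on top of
  \<^locale>\<open>ring\<close>, with scalars of type \<^typ>\<open>complex\<close>.
\<close>

record 'a star_alg = "(complex, 'a) module" +
  star :: "'a \<Rightarrow> 'a"

locale star_algebra = ring A for A :: "('a, 'm) star_alg_scheme" (structure) +
  assumes smult_closed: "x \<in> carrier A \<Longrightarrow> c \<odot> x \<in> carrier A"
    and smult_l_distr: "x \<in> carrier A \<Longrightarrow> (c + d) \<odot> x = c \<odot> x \<oplus> d \<odot> x"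
    and smult_r_distr: "x \<in> carrier A \<Longrightarrow> y \<in> carrier A \<Longrightarrow> c \<odot> (x \<oplus> y) = c \<odot> x \<oplus> c \<odot> y"
    and smult_assoc: "x \<in> carrier A \<Longrightarrow> (c * d) \<odot> x = c \<odot> (d \<odot> x)"
    and smult_one: "x \<in> carrier A \<Longrightarrow> 1 \<odot> x = x"
    and smult_mult_left: "x \<in> carrier A \<Longrightarrow> y \<in> carrier A \<Longrightarrow> (c \<odot> x) \<otimes> y = c \<odot> (x \<otimes> y)"
    and smult_mult_right: "x \<in> carrier A \<Longrightarrow> y \<in> carrier A \<Longrightarrow> x \<otimes> (c \<odot> y) = c \<odot> (x \<otimes> y)"
    and star_closed: "x \<in> carrier A \<Longrightarrow> star A x \<in> carrier A"
    and star_add: "x \<in> carrier A \<Longrightarrow> y \<in> carrier A \<Longrightarrow> star A (x \<oplus> y) = star A x \<oplus> star A y"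
    and star_smult: "x \<in> carrier A \<Longrightarrow> star A (c \<odot> x) = cnj c \<odot> star A x"
    and star_mult: "x \<in> carrier A \<Longrightarrow> y \<in> carrier A \<Longrightarrow> star A (x \<otimes> y) = star A y \<otimes> star A x"
    and star_star: "x \<in> carrier A \<Longrightarrow> star A (star A x) = x"

definition lin_map ::
    "('a, 'm) star_alg_scheme \<Rightarrow> ('b, 'n) star_alg_scheme \<Rightarrow> ('a \<Rightarrow> 'b) set" where
  "lin_map A B = {f. f \<in> carrier A \<rightarrow> carrier B \<and>
     (\<forall>x\<in>carrier A. \<forall>y\<in>carrier A. f (x \<oplus>\<^bsub>A\<^esub> y) = f x \<oplus>\<^bsub>B\<^esub> f y) \<and>
     (\<forall>c. \<forall>x\<in>carrier A. f (c \<odot>\<^bsub>A\<^esub> x) = c \<odot>\<^bsub>B\<^esub> f x)}"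

definition alg_hom ::
    "('a, 'm) star_alg_scheme \<Rightarrow> ('b, 'n) star_alg_scheme \<Rightarrow> ('a \<Rightarrow> 'b) set" where
  "alg_hom A B = ring_hom A B \<inter> lin_map A B"

definition complex_alg :: "complex star_alg" where
  "complex_alg = \<lparr>carrier = UNIV, mult = (*), one = 1, zero = 0, add = (+),
     smult = (*), star = cnj\<rparr>"

text \<open>
  The quotient by an additive subgroup \<open>I\<close>; it is a *-algebra when \<open>I\<close> is an ideal closed
  under the involution.
\<close>

definition quot_alg :: "('a, 'm) star_alg_scheme \<Rightarrow> 'a set \<Rightarrow> 'a set star_alg" where
  "quot_alg A I = \<lparr>
     carrier = carrier (A Quot I), mult = mult (A Quot I), one = one (A Quot I),
     zero = zero (A Quot I), add = add (A Quot I),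
     smult = (\<lambda>c X. \<Union>x\<in>X. I +>\<^bsub>A\<^esub> (c \<odot>\<^bsub>A\<^esub> x)),
     star = (\<lambda>X. \<Union>x\<in>X. I +>\<^bsub>A\<^esub> star A x)\<rparr>"

text \<open>
  The *-algebra of finitely supported complex functions on a monoid \<open>M\<close> with convolution
  product; \<open>\<tau>\<close> is an involutive anti-automorphism of \<open>M\<close>, extended antilinearly.
\<close>

definition monoid_alg ::
    "('k, 'm) monoid_scheme \<Rightarrow> ('k \<Rightarrow> 'k) \<Rightarrow> ('k \<Rightarrow>\<^sub>0 complex) star_alg" where
  "monoid_alg M \<tau> = \<lparr>
     carrier = {f. Poly_Mapping.keys f \<subseteq> carrier M},
     mult = (\<lambda>f g. \<Sum>k\<in>Poly_Mapping.keys f. \<Sum>l\<in>Poly_Mapping.keys g.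
               Poly_Mapping.single (k \<otimes>\<^bsub>M\<^esub> l)
                 (Poly_Mapping.lookup f k * Poly_Mapping.lookup g l)),
     one = Poly_Mapping.single \<one>\<^bsub>M\<^esub> 1,
     zero = 0,
     add = (+),
     smult = (\<lambda>c f. Poly_Mapping.map (\<lambda>a. c * a) f),
     star = (\<lambda>f. \<Sum>k\<in>Poly_Mapping.keys f.
               Poly_Mapping.single (\<tau> k) (cnj (Poly_Mapping.lookup f k)))\<rparr>"

definition lin_ext :: "('b, 'm) star_alg_scheme \<Rightarrow> ('k \<Rightarrow> 'b) \<Rightarrow> ('k \<Rightarrow>\<^sub>0 complex) \<Rightarrow> 'b" where
  "lin_ext B \<phi> f =
     (\<Oplus>\<^bsub>B\<^esub>k\<in>Poly_Mapping.keys f. Poly_Mapping.lookup f k \<odot>\<^bsub>B\<^esub> \<phi> k)"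

section \<open>Tensor products\<close>

text \<open>
  Formal linear combinations of pairs, modulo the linear span of the bilinearity relations.
  The product \<open>(a, b) (a', b') = (a a', b b')\<close> and the involution are those of the monoid
  algebra of \<open>A \<times>\<times> B\<close>.
\<close>

definition formal_tensors ::
    "('a, 'm) star_alg_scheme \<Rightarrow> ('b, 'n) star_alg_scheme \<Rightarrow> ('a \<times> 'b \<Rightarrow>\<^sub>0 complex) star_alg" where
  "formal_tensors A B = monoid_alg (A \<times>\<times> B) (map_prod (star A) (star B))"

inductive_set bilinear_rels ::
    "('a, 'm) star_alg_scheme \<Rightarrow> ('b, 'n) star_alg_scheme \<Rightarrow> ('a \<times> 'b \<Rightarrow>\<^sub>0 complex) set"
  for A :: "('a, 'm) star_alg_scheme" and B :: "('b, 'n) star_alg_scheme" where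
  add_left: "\<lbrakk>a \<in> carrier A; a' \<in> carrier A; b \<in> carrier B\<rbrakk> \<Longrightarrow>
    Poly_Mapping.single (a \<oplus>\<^bsub>A\<^esub> a', b) 1
      - (Poly_Mapping.single (a, b) 1 + Poly_Mapping.single (a', b) 1) \<in> bilinear_rels A B"
| add_right: "\<lbrakk>a \<in> carrier A; b \<in> carrier B; b' \<in> carrier B\<rbrakk> \<Longrightarrow>
    Poly_Mapping.single (a, b \<oplus>\<^bsub>B\<^esub> b') 1
      - (Poly_Mapping.single (a, b) 1 + Poly_Mapping.single (a, b') 1) \<in> bilinear_rels A B"
| smult_left: "\<lbrakk>a \<in> carrier A; b \<in> carrier B\<rbrakk> \<Longrightarrow>
    Poly_Mapping.single (c \<odot>\<^bsub>A\<^esub> a, b) 1 - Poly_Mapping.single (a, b) c \<in> bilinear_rels A B"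
| smult_right: "\<lbrakk>a \<in> carrier A; b \<in> carrier B\<rbrakk> \<Longrightarrow>
    Poly_Mapping.single (a, c \<odot>\<^bsub>B\<^esub> b) 1 - Poly_Mapping.single (a, b) c \<in> bilinear_rels A B"

inductive_set lin_span :: "('a, 'm) star_alg_scheme \<Rightarrow> 'a set \<Rightarrow> 'a set"
  for A :: "('a, 'm) star_alg_scheme" (structure) and S :: "'a set" where
  zero: "\<zero> \<in> lin_span A S"
| base: "x \<in> S \<Longrightarrow> x \<in> lin_span A S"
| add: "\<lbrakk>x \<in> lin_span A S; y \<in> lin_span A S\<rbrakk> \<Longrightarrow> x \<oplus> y \<in> lin_span A S"
| smult: "x \<in> lin_span A S \<Longrightarrow> c \<odot> x \<in> lin_span A S"

definition tensor_null ::
    "('a, 'm) star_alg_scheme \<Rightarrow> ('b, 'n) star_alg_scheme \<Rightarrow> ('a \<times> 'b \<Rightarrow>\<^sub>0 complex) set" where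
  "tensor_null A B = lin_span (formal_tensors A B) (bilinear_rels A B)"

definition tensor_alg ::
    "('a, 'm) star_alg_scheme \<Rightarrow> ('b, 'n) star_alg_scheme \<Rightarrow>
     ('a \<times> 'b \<Rightarrow>\<^sub>0 complex) set star_alg" where
  "tensor_alg A B = quot_alg (formal_tensors A B) (tensor_null A B)"

definition tensor ::
    "('a, 'm) star_alg_scheme \<Rightarrow> ('b, 'n) star_alg_scheme \<Rightarrow> 'a \<Rightarrow> 'b \<Rightarrow>
     ('a \<times> 'b \<Rightarrow>\<^sub>0 complex) set" where
  "tensor A B a b = tensor_null A B +>\<^bsub>formal_tensors A B\<^esub> Poly_Mapping.single (a, b) 1"

text \<open>
  The linear map \<open>A \<otimes> B \<rightarrow> C\<close> induced by a bilinear map \<open>\<beta>\<close>: the extension of \<open>\<beta>\<close> to formal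
  combinations is constant on cosets.
\<close>

definition tensor_lift ::
    "('c, 'm) star_alg_scheme \<Rightarrow> ('a \<Rightarrow> 'b \<Rightarrow> 'c) \<Rightarrow> ('a \<times> 'b \<Rightarrow>\<^sub>0 complex) set \<Rightarrow> 'c" where
  "tensor_lift C \<beta> X = the_elem (lin_ext C (case_prod \<beta>) ` X)"

definition tensor_map ::
    "('c, 'm) star_alg_scheme \<Rightarrow> ('d, 'n) star_alg_scheme \<Rightarrow> ('a \<Rightarrow> 'c) \<Rightarrow> ('b \<Rightarrow> 'd) \<Rightarrow>
     ('a \<times> 'b \<Rightarrow>\<^sub>0 complex) set \<Rightarrow> ('c \<times> 'd \<Rightarrow>\<^sub>0 complex) set" where
  "tensor_map C D f g = tensor_lift (tensor_alg C D) (\<lambda>a b. tensor C D (f a) (g b))"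

definition tensor_assoc ::
    "('a, 'm) star_alg_scheme \<Rightarrow> ('b, 'n) star_alg_scheme \<Rightarrow> ('c, 'o) star_alg_scheme \<Rightarrow>
     (('a \<times> 'b \<Rightarrow>\<^sub>0 complex) set \<times> 'c \<Rightarrow>\<^sub>0 complex) set \<Rightarrow>
     ('a \<times> ('b \<times> 'c \<Rightarrow>\<^sub>0 complex) set \<Rightarrow>\<^sub>0 complex) set" where
  "tensor_assoc A B C =
     (let T = tensor_alg A (tensor_alg B C) in
      tensor_lift T (\<lambda>X c. tensor_lift T (\<lambda>a b. tensor A (tensor_alg B C) a (tensor B C b c)) X))"

section \<open>Hopf algebras and comodule algebras\<close>

record 'h hopf_alg = "'h star_alg" +
  comult :: "'h \<Rightarrow> ('h \<times> 'h \<Rightarrow>\<^sub>0 complex) set"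
  counit :: "'h \<Rightarrow> complex"
  antipode :: "'h \<Rightarrow> 'h"

locale hopf_algebra = star_algebra H for H :: "('h, 'm) hopf_alg_scheme" (structure) +
  assumes comult_hom: "comult H \<in> alg_hom H (tensor_alg H H)"
    and counit_hom: "counit H \<in> alg_hom H complex_alg"
    and coassoc: "h \<in> carrier H \<Longrightarrow>
      tensor_assoc H H H (tensor_map (tensor_alg H H) H (comult H) id (comult H h)) =
      tensor_map H (tensor_alg H H) id (comult H) (comult H h)"
    and counit_left: "h \<in> carrier H \<Longrightarrow>
      tensor_lift H (\<lambda>a b. counit H a \<odot> b) (comult H h) = h"
    and counit_right: "h \<in> carrier H \<Longrightarrow>
      tensor_lift H (\<lambda>a b. counit H b \<odot> a) (comult H h) = h"
    and antipode_lin: "antipode H \<in> lin_map H H"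
    and antipode_left: "h \<in> carrier H \<Longrightarrow>
      tensor_lift H (\<lambda>a b. antipode H a \<otimes> b) (comult H h) = counit H h \<odot> \<one>"
    and antipode_right: "h \<in> carrier H \<Longrightarrow>
      tensor_lift H (\<lambda>a b. a \<otimes> antipode H b) (comult H h) = counit H h \<odot> \<one>"
    and antipode_bij: "bij_betw (antipode H) (carrier H) (carrier H)"

locale right_comodule_algebra = hopf_algebra H + star_algebra A
  for A :: "('a, 'm) star_alg_scheme" and H :: "('h, 'n) hopf_alg_scheme"
    and \<rho> :: "'a \<Rightarrow> ('a \<times> 'h \<Rightarrow>\<^sub>0 complex) set" +
  assumes coaction_hom: "\<rho> \<in> alg_hom A (tensor_alg A H)"
    and coaction_coassoc: "a \<in> carrier A \<Longrightarrow>
      tensor_assoc A H H (tensor_map (tensor_alg A H) H \<rho> id (\<rho> a)) =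
      tensor_map A (tensor_alg H H) id (comult H) (\<rho> a)"
    and coaction_counit: "a \<in> carrier A \<Longrightarrow>
      tensor_lift A (\<lambda>b h. counit H h \<odot>\<^bsub>A\<^esub> b) (\<rho> a) = a"

definition trivial_comodule_algebra ::
    "('a, 'm) star_alg_scheme \<Rightarrow> ('h, 'n) hopf_alg_scheme \<Rightarrow>
     ('a \<Rightarrow> ('a \<times> 'h \<Rightarrow>\<^sub>0 complex) set) \<Rightarrow> bool" where
  "trivial_comodule_algebra A H \<rho> \<longleftrightarrow>
     right_comodule_algebra A H \<rho> \<and>
     (\<exists>j \<in> alg_hom H A. \<forall>h \<in> carrier H. \<rho> (j h) = tensor_map A H j id (comult H h))"

section \<open>The Hopf algebra of Laurent polynomials\<close>

text \<open>\<open>Poly_Mapping.single n c\<close> stands for \<open>c u\<^sup>n\<close>, with \<open>n\<close> an integer.\<close>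

definition laurent_alg :: "(int \<Rightarrow>\<^sub>0 complex) star_alg" where
  "laurent_alg = monoid_alg integer_group uminus"

definition upow :: "int \<Rightarrow> (int \<Rightarrow>\<^sub>0 complex)" where
  "upow n = Poly_Mapping.single n 1"

definition OU1 :: "(int \<Rightarrow>\<^sub>0 complex) hopf_alg" where
  "OU1 = star_alg.extend laurent_alg
     (hopf_alg.fields
       (lin_ext (tensor_alg laurent_alg laurent_alg)
         (\<lambda>n. tensor laurent_alg laurent_alg (upow n) (upow n)))
       (lin_ext complex_alg (\<lambda>n. 1))
       (lin_ext laurent_alg (\<lambda>n. upow (- n))))"

section \<open>*-Algebras given by generators and relations\<close>

datatype 'g letter = Gen 'g | Adj 'g

primrec swap_letter :: "'g letter \<Rightarrow> 'g letter" where
  "swap_letter (Gen g) = Adj g"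
| "swap_letter (Adj g) = Gen g"

definition free_star_alg :: "('g letter list \<Rightarrow>\<^sub>0 complex) star_alg" where
  "free_star_alg =
     monoid_alg \<lparr>carrier = UNIV, mult = (@), one = []\<rparr> (\<lambda>w. rev (map swap_letter w))"

definition free_gen :: "'g \<Rightarrow> ('g letter list \<Rightarrow>\<^sub>0 complex)" where
  "free_gen g = Poly_Mapping.single [Gen g] 1"

text \<open>A pair \<open>(s, t)\<close> in \<open>R\<close> is the relation \<open>s = t\<close>; it also imposes the adjoint relation.\<close>

definition rel_ideal ::
    "(('g letter list \<Rightarrow>\<^sub>0 complex) \<times> ('g letter list \<Rightarrow>\<^sub>0 complex)) set \<Rightarrow>
     ('g letter list \<Rightarrow>\<^sub>0 complex) set" where
  "rel_ideal R =
     (let D = (\<lambda>(s, t). s - t) ` R in Idl\<^bsub>free_star_alg\<^esub> (D \<union> star free_star_alg ` D))"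

definition presented_alg ::
    "(('g letter list \<Rightarrow>\<^sub>0 complex) \<times> ('g letter list \<Rightarrow>\<^sub>0 complex)) set \<Rightarrow>
     ('g letter list \<Rightarrow>\<^sub>0 complex) set star_alg" where
  "presented_alg R = quot_alg free_star_alg (rel_ideal R)"

definition presented_gen ::
    "(('g letter list \<Rightarrow>\<^sub>0 complex) \<times> ('g letter list \<Rightarrow>\<^sub>0 complex)) set \<Rightarrow> 'g \<Rightarrow>
     ('g letter list \<Rightarrow>\<^sub>0 complex) set" where
  "presented_gen R g = rel_ideal R +>\<^bsub>free_star_alg\<^esub> free_gen g"

primrec letter_val :: "('b, 'm) star_alg_scheme \<Rightarrow> ('g \<Rightarrow> 'b) \<Rightarrow> 'g letter \<Rightarrow> 'b" where
  "letter_val B \<phi> (Gen g) = \<phi> g"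
| "letter_val B \<phi> (Adj g) = star B (\<phi> g)"

definition word_val :: "('b, 'm) star_alg_scheme \<Rightarrow> ('g \<Rightarrow> 'b) \<Rightarrow> 'g letter list \<Rightarrow> 'b" where
  "word_val B \<phi> w = foldr (\<lambda>a b. letter_val B \<phi> a \<otimes>\<^bsub>B\<^esub> b) w \<one>\<^bsub>B\<^esub>"

text \<open>
  The *-homomorphism from a presented *-algebra to \<open>B\<close> sending each generator \<open>g\<close> to \<open>\<phi> g\<close>,
  provided that the elements \<open>\<phi> g\<close> satisfy the defining relations: evaluation of
  noncommutative *-polynomials is then constant on cosets.
\<close>

definition presented_lift ::
    "('b, 'm) star_alg_scheme \<Rightarrow> ('g \<Rightarrow> 'b) \<Rightarrow> ('g letter list \<Rightarrow>\<^sub>0 complex) set \<Rightarrow> 'b" where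
  "presented_lift B \<phi> X = the_elem (lin_ext B (word_val B \<phi>) ` X)"

section \<open>The algebra \<open>\<O>(\<Sigma>\<^sub>q\<^sup>3(l,+))\<close> and its coaction\<close>

datatype sigma_gen = X' | Y' | Z'

definition list_prod :: "('a, 'm) monoid_scheme \<Rightarrow> 'a list \<Rightarrow> 'a" where
  "list_prod A xs = foldr (\<lambda>a b. a \<otimes>\<^bsub>A\<^esub> b) xs \<one>\<^bsub>A\<^esub>"

text \<open>
  Centrality of \<open>z'\<close> is imposed by commutation with \<open>x'\<close>, \<open>y'\<close> and their adjoints;
  commutation with \<open>z'\<^sup>*\<close> follows from unitarity.
\<close>

definition sigma_rels ::
    "real \<Rightarrow> nat \<Rightarrow>
     ((sigma_gen letter list \<Rightarrow>\<^sub>0 complex) \<times> (sigma_gen letter list \<Rightarrow>\<^sub>0 complex)) set" where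
  "sigma_rels q l =
    (let F = free_star_alg; Q = complex_of_real q;
         x = free_gen X'; y = free_gen Y'; z = free_gen Z';
         xs = star F x; ys = star F y; zs = star F z
     in {(z \<otimes>\<^bsub>F\<^esub> zs, \<one>\<^bsub>F\<^esub>),
         (zs \<otimes>\<^bsub>F\<^esub> z, \<one>\<^bsub>F\<^esub>),
         (z \<otimes>\<^bsub>F\<^esub> x, x \<otimes>\<^bsub>F\<^esub> z),
         (z \<otimes>\<^bsub>F\<^esub> xs, xs \<otimes>\<^bsub>F\<^esub> z),
         (z \<otimes>\<^bsub>F\<^esub> y, y \<otimes>\<^bsub>F\<^esub> z),
         (z \<otimes>\<^bsub>F\<^esub> ys, ys \<otimes>\<^bsub>F\<^esub> z),
         (x \<otimes>\<^bsub>F\<^esub> y, Q ^ (2 * l) \<odot>\<^bsub>F\<^esub> (y \<otimes>\<^bsub>F\<^esub> x)),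
         (x \<otimes>\<^bsub>F\<^esub> ys, Q ^ (2 * l) \<odot>\<^bsub>F\<^esub> (ys \<otimes>\<^bsub>F\<^esub> x)),
         (y \<otimes>\<^bsub>F\<^esub> ys, ys \<otimes>\<^bsub>F\<^esub> y),
         (ys, y \<otimes>\<^bsub>F\<^esub> (z \<otimes>\<^bsub>F\<^esub> z)),
         (x \<otimes>\<^bsub>F\<^esub> xs,
          list_prod F (map (\<lambda>p. \<one>\<^bsub>F\<^esub> - Q ^ (2 * p) \<odot>\<^bsub>F\<^esub> (y \<otimes>\<^bsub>F\<^esub> z)) [0..<l])),
         (xs \<otimes>\<^bsub>F\<^esub> x,
          list_prod F (map (\<lambda>p. \<one>\<^bsub>F\<^esub> - inverse (Q ^ (2 * p)) \<odot>\<^bsub>F\<^esub> (y \<otimes>\<^bsub>F\<^esub> z)) [1..<Suc l]))})"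

definition O_Sigma3 :: "real \<Rightarrow> nat \<Rightarrow> (sigma_gen letter list \<Rightarrow>\<^sub>0 complex) set star_alg" where
  "O_Sigma3 q l = presented_alg (sigma_rels q l)"

primrec sigma_degree :: "sigma_gen \<Rightarrow> int" where
  "sigma_degree X' = 1"
| "sigma_degree Y' = 1"
| "sigma_degree Z' = - 1"

definition Omega ::
    "real \<Rightarrow> nat \<Rightarrow> (sigma_gen letter list \<Rightarrow>\<^sub>0 complex) set \<Rightarrow>
     ((sigma_gen letter list \<Rightarrow>\<^sub>0 complex) set \<times> (int \<Rightarrow>\<^sub>0 complex) \<Rightarrow>\<^sub>0 complex) set" where
  "Omega q l = presented_lift (tensor_alg (O_Sigma3 q l) OU1)
     (\<lambda>g. tensor (O_Sigma3 q l) OU1 (presented_gen (sigma_rels q l) g) (upow (sigma_degree g)))"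

end

theory Submission
  imports Defs
begin

text \<open>
  The generator \<open>z'\<close> is unitary and has degree \<open>-1\<close> under the coaction, so \<open>z'\<^sup>*\<close> is an invertible
  element of degree \<open>1\<close>.  The powers of such an element form a group homomorphism from the integers
  to the units of the algebra, and its linear extension \<open>j(u\<^sup>n) = (z'\<^sup>*)\<^sup>n\<close> is an algebra map that is
  colinear because \<open>(z'\<^sup>*)\<^sup>n\<close> has degree \<open>n\<close>.  Only this last step, \<open>trivial_comodule_algebraI\<close>,
  concerns triviality.  The bulk of the work is to see that the data form a comodule algebra at all:
  that Laurent polynomials are a Hopf algebra and that the coaction is well defined, multiplicative,
  coassociative and counital.

  Well-definedness of the coaction \<open>\<Omega>\<close> does not require computing with the defining relations.  Give
  the generators \<open>x', y', z'\<close> the degrees \<open>1, 1, -1\<close> and their adjoints the opposite degrees; both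
  sides of every relation are then homogeneous of the same degree.  On the free *-algebra, the
  homomorphism induced by the prescribed images of the generators sends a homogeneous element \<open>s\<close> of
  degree \<open>d\<close> to \<open>[s] \<otimes> u\<^sup>d\<close>, where \<open>[s]\<close> is the class of \<open>s\<close> in the presented algebra
  (\<open>word_val_coaction_homogeneous\<close>).  If \<open>s = t\<close> is a relation, then \<open>[s] = [t]\<close> and the degrees
  agree, so \<open>s\<close> and \<open>t\<close> have the same image.  The coaction axioms follow because homogeneous elements
  span: all maps involved are linear, and on \<open>[s]\<close> they only copy or erase the factor \<open>u\<^sup>d\<close>.  This
  argument works for every presentation by homogeneous relations (\<open>graded_comodule_algebra\<close>).

  All identities between maps out of monoid algebras, quotients and tensor products are obtained in
  the same way: both sides are shown to be linear, and they are compared on a spanning family (basis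
  elements, cosets, pure tensors).  The extension principles that make this possible are
  \<open>lin_ext_lin_map\<close>, \<open>lin_map_quot_alg\<close> and \<open>tensor_lift_lin_map\<close>, with the uniqueness statements
  \<open>lin_map_eqI_monoid_alg\<close> and \<open>lin_map_eqI_tensor_alg\<close>.
\<close>

section \<open>Linear maps between *-algebras\<close>

context star_algebra
begin

lemma smult_zero_left: "x \<in> carrier A \<Longrightarrow> 0 \<odot> x = \<zero>"
  by (metis add.l_cancel_one' add_0 smult_closed smult_l_distr)

lemma smult_zero_right: "c \<odot> \<zero> = \<zero>"
  by (metis smult_assoc smult_zero_left mult_zero_right zero_closed)

lemma a_inv_smult:
  assumes "x \<in> carrier A"
  shows "\<ominus> x = (- 1) \<odot> x"
proof (rule minus_equality)
  have "(- 1) \<odot> x \<oplus> 1 \<odot> x = (- 1 + 1) \<odot> x"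
    by (rule smult_l_distr[symmetric]) (rule assms)
  then show "(- 1) \<odot> x \<oplus> x = \<zero>"
    using assms by (simp add: smult_one smult_zero_left)
qed (use assms in \<open>auto simp: smult_closed\<close>)

lemma star_zero: "star A \<zero> = \<zero>"
  by (metis complex_cnj_zero smult_zero_left star_closed star_smult zero_closed)

lemma star_one: "star A \<one> = \<one>"
proof -
  have "star A \<one> = star A \<one> \<otimes> star A (star A \<one>)"
    by (simp add: star_closed star_star)
  also have "\<dots> = star A (star A \<one> \<otimes> \<one>)"
    by (rule star_mult[symmetric]) (simp_all add: star_closed)
  also have "\<dots> = \<one>"
    by (simp add: star_closed star_star)
  finally show ?thesis .
qed

lemma smult_one_mult: "x \<in> carrier A \<Longrightarrow> c \<odot> x = (c \<odot> \<one>) \<otimes> x"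
  by (simp add: smult_mult_left)

lemma ideal_smult_closed: "ideal I A \<Longrightarrow> x \<in> I \<Longrightarrow> c \<odot> x \<in> I"
  by (subst smult_one_mult) (auto intro: ideal.I_l_closed ideal.Icarr smult_closed)

end

lemma lin_mapI:
  assumes "\<And>x. x \<in> carrier A \<Longrightarrow> f x \<in> carrier B"
    and "\<And>x y. x \<in> carrier A \<Longrightarrow> y \<in> carrier A \<Longrightarrow> f (x \<oplus>\<^bsub>A\<^esub> y) = f x \<oplus>\<^bsub>B\<^esub> f y"
    and "\<And>c x. x \<in> carrier A \<Longrightarrow> f (c \<odot>\<^bsub>A\<^esub> x) = c \<odot>\<^bsub>B\<^esub> f x"
  shows "f \<in> lin_map A B"
  using assms by (auto simp: lin_map_def)

lemma lin_mapD:
  assumes "f \<in> lin_map A B"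
  shows lin_map_closed: "\<And>x. x \<in> carrier A \<Longrightarrow> f x \<in> carrier B"
    and lin_map_add: "\<And>x y. x \<in> carrier A \<Longrightarrow> y \<in> carrier A \<Longrightarrow> f (x \<oplus>\<^bsub>A\<^esub> y) = f x \<oplus>\<^bsub>B\<^esub> f y"
    and lin_map_smult: "\<And>c x. x \<in> carrier A \<Longrightarrow> f (c \<odot>\<^bsub>A\<^esub> x) = c \<odot>\<^bsub>B\<^esub> f x"
  using assms by (auto simp: lin_map_def)

lemma alg_homI:
  assumes "f \<in> lin_map A B"
    and "\<And>x y. x \<in> carrier A \<Longrightarrow> y \<in> carrier A \<Longrightarrow> f (x \<otimes>\<^bsub>A\<^esub> y) = f x \<otimes>\<^bsub>B\<^esub> f y"
    and "f \<one>\<^bsub>A\<^esub> = \<one>\<^bsub>B\<^esub>"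
  shows "f \<in> alg_hom A B"
  using assms by (auto simp: alg_hom_def ring_hom_def lin_mapD)

lemma alg_homD:
  assumes "f \<in> alg_hom A B"
  shows alg_hom_lin: "f \<in> lin_map A B"
    and alg_hom_mult: "\<And>x y. x \<in> carrier A \<Longrightarrow> y \<in> carrier A \<Longrightarrow> f (x \<otimes>\<^bsub>A\<^esub> y) = f x \<otimes>\<^bsub>B\<^esub> f y"
    and alg_hom_one: "f \<one>\<^bsub>A\<^esub> = \<one>\<^bsub>B\<^esub>"
  using assms by (auto simp: alg_hom_def ring_hom_def)

lemma lin_map_comp:
  "f \<in> lin_map A B \<Longrightarrow> g \<in> lin_map B C \<Longrightarrow> (\<lambda>x. g (f x)) \<in> lin_map A C"
  by (auto simp: lin_map_def Pi_iff)

lemma lin_map_id: "(\<lambda>x. x) \<in> lin_map A A"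
  by (auto simp: lin_map_def)

lemma lin_map_zero:
  assumes "star_algebra A" "star_algebra B" "f \<in> lin_map A B"
  shows "f \<zero>\<^bsub>A\<^esub> = \<zero>\<^bsub>B\<^esub>"
proof -
  interpret A: star_algebra A by fact
  interpret B: star_algebra B by fact
  show ?thesis
    using lin_map_smult[OF assms(3) A.zero_closed, of 0] lin_map_closed[OF assms(3) A.zero_closed]
    by (simp add: A.smult_zero_left B.smult_zero_left)
qed

lemma lin_map_minus:
  assumes "star_algebra A" "star_algebra B" "f \<in> lin_map A B" "x \<in> carrier A" "y \<in> carrier A"
  shows "f (x \<ominus>\<^bsub>A\<^esub> y) = f x \<ominus>\<^bsub>B\<^esub> f y"
proof -
  interpret A: star_algebra A by fact
  interpret B: star_algebra B by fact
  show ?thesis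
    using assms(3-) by (simp add: a_minus_def A.a_inv_smult B.a_inv_smult lin_mapD A.smult_closed)
qed

lemma lin_map_mult_left:
  assumes "star_algebra A" "y \<in> carrier A"
  shows "(\<lambda>x. y \<otimes>\<^bsub>A\<^esub> x) \<in> lin_map A A"
proof -
  interpret star_algebra A by fact
  show ?thesis using assms(2) by (intro lin_mapI) (auto simp: r_distr smult_mult_right)
qed

lemma lin_map_mult_right:
  assumes "star_algebra A" "y \<in> carrier A"
  shows "(\<lambda>x. x \<otimes>\<^bsub>A\<^esub> y) \<in> lin_map A A"
proof -
  interpret star_algebra A by fact
  show ?thesis using assms(2) by (intro lin_mapI) (auto simp: l_distr smult_mult_left)
qed

lemma lin_map_smult_map:
  assumes "star_algebra A"
  shows "(\<lambda>x. c \<odot>\<^bsub>A\<^esub> x) \<in> lin_map A A"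
proof -
  interpret star_algebra A by fact
  show ?thesis
    by (intro lin_mapI) (simp_all add: smult_closed smult_r_distr flip: smult_assoc, simp add: mult.commute)
qed

section \<open>Monoid algebras\<close>

lemma monoid_alg_simps:
  "x \<in> carrier (monoid_alg M \<tau>) \<longleftrightarrow> Poly_Mapping.keys x \<subseteq> carrier M"
  "\<one>\<^bsub>monoid_alg M \<tau>\<^esub> = Poly_Mapping.single \<one>\<^bsub>M\<^esub> 1"
  "\<zero>\<^bsub>monoid_alg M \<tau>\<^esub> = 0"
  "x \<oplus>\<^bsub>monoid_alg M \<tau>\<^esub> y = x + y"
  by (simp_all add: monoid_alg_def)

lemma lookup_smult_monoid_alg:
  "Poly_Mapping.lookup (c \<odot>\<^bsub>monoid_alg M \<tau>\<^esub> x) k = c * Poly_Mapping.lookup x k"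
  by (simp add: monoid_alg_def Poly_Mapping.map.rep_eq when_def)

lemma smult_single_monoid_alg:
  "c \<odot>\<^bsub>monoid_alg M \<tau>\<^esub> Poly_Mapping.single k a = Poly_Mapping.single k (c * a)"
  by (simp add: monoid_alg_def)

lemma keys_smult_monoid_alg:
  "Poly_Mapping.keys (c \<odot>\<^bsub>monoid_alg M \<tau>\<^esub> x) \<subseteq> Poly_Mapping.keys x"
  by (auto simp: in_keys_iff lookup_smult_monoid_alg)

lemma single_in_monoid_alg:
  "k \<in> carrier M \<Longrightarrow> Poly_Mapping.single k a \<in> carrier (monoid_alg M \<tau>)"
  by (simp add: monoid_alg_simps)

lemma poly_mapping_eq_sum_single:
  "x = (\<Sum>k\<in>Poly_Mapping.keys x. Poly_Mapping.single k (Poly_Mapping.lookup x k))"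
proof (rule poly_mapping_eqI)
  fix l
  have "Poly_Mapping.lookup x l = (\<Sum>k\<in>Poly_Mapping.keys x. if k = l then Poly_Mapping.lookup x k else 0)"
    by (simp add: in_keys_iff)
  then show "Poly_Mapping.lookup x l = Poly_Mapping.lookup
      (\<Sum>k\<in>Poly_Mapping.keys x. Poly_Mapping.single k (Poly_Mapping.lookup x k)) l"
    by (simp add: lookup_sum lookup_single when_def)
qed

text \<open>
  Every finitely supported function is the sum of its monomials.  The set \<open>K\<close> serves for the elements of
  a monoid algebra as well as for the homogeneous elements of a given degree.
\<close>

lemma supported_induct [consumes 1, case_names zero add single]:
  fixes x :: "'k \<Rightarrow>\<^sub>0 complex"
  assumes x: "Poly_Mapping.keys x \<subseteq> K"
    and zero: "P 0"
    and add: "\<And>x y. Poly_Mapping.keys x \<subseteq> K \<Longrightarrow> Poly_Mapping.keys y \<subseteq> K \<Longrightarrow>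
      P x \<Longrightarrow> P y \<Longrightarrow> P (x + y)"
    and single: "\<And>k a. k \<in> K \<Longrightarrow> P (Poly_Mapping.single k a)"
  shows "P x"
proof -
  have "S \<subseteq> K \<Longrightarrow>
      P (\<Sum>k\<in>S. Poly_Mapping.single k (c k)) \<and>
      Poly_Mapping.keys (\<Sum>k\<in>S. Poly_Mapping.single k (c k)) \<subseteq> K"
    if "finite S" for S and c :: "'k \<Rightarrow> complex"
    using that
  proof (induction S)
    case (insert k S)
    then show ?case
      using keys_add[of "Poly_Mapping.single k (c k)" "\<Sum>k\<in>S. Poly_Mapping.single k (c k)"]
      by (auto simp: zero intro!: add single split: if_splits)
  qed (simp add: zero)
  from this[of "Poly_Mapping.keys x" "Poly_Mapping.lookup x"] x show ?thesis
    by (simp flip: poly_mapping_eq_sum_single)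
qed

lemma monoid_alg_induct [consumes 1, case_names zero add single]:
  assumes "x \<in> carrier (monoid_alg M \<tau>)"
    and "P 0"
    and "\<And>x y. x \<in> carrier (monoid_alg M \<tau>) \<Longrightarrow> y \<in> carrier (monoid_alg M \<tau>) \<Longrightarrow>
      P x \<Longrightarrow> P y \<Longrightarrow> P (x + y)"
    and "\<And>k a. k \<in> carrier M \<Longrightarrow> P (Poly_Mapping.single k a)"
  shows "P x"
  using supported_induct[of x "carrier M" P] assms by (simp add: monoid_alg_simps)

lemma mult_add_left_monoid_alg:
  "(x + y) \<otimes>\<^bsub>monoid_alg M \<tau>\<^esub> z = x \<otimes>\<^bsub>monoid_alg M \<tau>\<^esub> z + y \<otimes>\<^bsub>monoid_alg M \<tau>\<^esub> z"
  unfolding monoid_alg_def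
  by (simp, subst setsum_keys_plus_distrib) (simp_all add: distrib_right single_add sum.distrib)

lemma mult_add_right_monoid_alg:
  "z \<otimes>\<^bsub>monoid_alg M \<tau>\<^esub> (x + y) = z \<otimes>\<^bsub>monoid_alg M \<tau>\<^esub> x + z \<otimes>\<^bsub>monoid_alg M \<tau>\<^esub> y"
  unfolding monoid_alg_def
  by (simp, subst setsum_keys_plus_distrib) (simp_all add: distrib_left single_add sum.distrib)

lemma mult_single_monoid_alg:
  "Poly_Mapping.single k a \<otimes>\<^bsub>monoid_alg M \<tau>\<^esub> Poly_Mapping.single l b =
    Poly_Mapping.single (k \<otimes>\<^bsub>M\<^esub> l) (a * b)"
  by (simp add: monoid_alg_def)

lemma mult_zero_monoid_alg:
  "0 \<otimes>\<^bsub>monoid_alg M \<tau>\<^esub> x = 0" "x \<otimes>\<^bsub>monoid_alg M \<tau>\<^esub> 0 = 0"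
  by (simp_all add: monoid_alg_def)

lemma star_add_monoid_alg:
  "star (monoid_alg M \<tau>) (x + y) = star (monoid_alg M \<tau>) x + star (monoid_alg M \<tau>) y"
  unfolding monoid_alg_def
  by (simp, subst setsum_keys_plus_distrib) (simp_all add: single_add)

lemma star_single_monoid_alg:
  "star (monoid_alg M \<tau>) (Poly_Mapping.single k a) = Poly_Mapping.single (\<tau> k) (cnj a)"
  by (simp add: monoid_alg_def)

lemma star_zero_monoid_alg: "star (monoid_alg M \<tau>) 0 = 0"
  by (simp add: monoid_alg_def)

lemma smult_add_monoid_alg:
  "c \<odot>\<^bsub>monoid_alg M \<tau>\<^esub> (x + y) = c \<odot>\<^bsub>monoid_alg M \<tau>\<^esub> x + c \<odot>\<^bsub>monoid_alg M \<tau>\<^esub> y"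
  by (rule poly_mapping_eqI) (simp add: lookup_smult_monoid_alg lookup_add distrib_left)

lemma smult_zero_monoid_alg: "c \<odot>\<^bsub>monoid_alg M \<tau>\<^esub> 0 = 0"
  by (rule poly_mapping_eqI) (simp add: lookup_smult_monoid_alg)

lemmas monoid_alg_linearity =
  mult_add_left_monoid_alg mult_add_right_monoid_alg mult_single_monoid_alg mult_zero_monoid_alg
  star_add_monoid_alg star_single_monoid_alg star_zero_monoid_alg
  smult_add_monoid_alg smult_single_monoid_alg smult_zero_monoid_alg

lemma monoid_alg_add_closed:
  "x \<in> carrier (monoid_alg M \<tau>) \<Longrightarrow> y \<in> carrier (monoid_alg M \<tau>) \<Longrightarrow>
    x + y \<in> carrier (monoid_alg M \<tau>)"
  using keys_add[of x y] by (auto simp: monoid_alg_simps)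

text \<open>
  All axioms are additive in each argument, so by induction they reduce to monomials, where they are
  the axioms of the monoid and of its anti-automorphism.
\<close>

lemma monoid_alg_star_algebra:
  assumes M: "Group.monoid M"
    and closed: "\<And>k. k \<in> carrier M \<Longrightarrow> \<tau> k \<in> carrier M"
    and invol: "\<And>k. k \<in> carrier M \<Longrightarrow> \<tau> (\<tau> k) = k"
    and anti: "\<And>k l. k \<in> carrier M \<Longrightarrow> l \<in> carrier M \<Longrightarrow> \<tau> (k \<otimes>\<^bsub>M\<^esub> l) = \<tau> l \<otimes>\<^bsub>M\<^esub> \<tau> k"
  shows "star_algebra (monoid_alg M \<tau>)"
proof -
  interpret M: Group.monoid M by fact
  let ?A = "monoid_alg M \<tau>"
  have mult_closed: "x \<otimes>\<^bsub>?A\<^esub> y \<in> carrier ?A" if x: "x \<in> carrier ?A" and y: "y \<in> carrier ?A" for x y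
    using x
  proof (induction rule: monoid_alg_induct)
    case (single k a)
    show ?case using y
      by (induction rule: monoid_alg_induct)
        (simp_all add: monoid_alg_linearity single monoid_alg_add_closed, simp_all add: single monoid_alg_simps)
  qed (simp_all add: monoid_alg_linearity monoid_alg_add_closed, simp add: monoid_alg_simps)
  have assoc: "(x \<otimes>\<^bsub>?A\<^esub> y) \<otimes>\<^bsub>?A\<^esub> z = x \<otimes>\<^bsub>?A\<^esub> (y \<otimes>\<^bsub>?A\<^esub> z)"
    if x: "x \<in> carrier ?A" and y: "y \<in> carrier ?A" and z: "z \<in> carrier ?A" for x y z
    using x
  proof (induction rule: monoid_alg_induct)
    case (single k a)
    note k = this
    show ?case using y
    proof (induction rule: monoid_alg_induct)
      case (single l b)
      show ?case using z
        by (induction rule: monoid_alg_induct) (simp_all add: monoid_alg_linearity k single M.m_assoc mult.assoc)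
    qed (simp_all add: monoid_alg_linearity)
  qed (simp_all add: monoid_alg_linearity)
  have ring: "ring ?A"
  proof (intro ringI abelian_groupI monoidI)
    show "\<exists>y\<in>carrier ?A. y \<oplus>\<^bsub>?A\<^esub> x = \<zero>\<^bsub>?A\<^esub>" if "x \<in> carrier ?A" for x
      using that by (intro bexI[of _ "- x"]) (simp_all add: monoid_alg_simps)
    show "\<one>\<^bsub>?A\<^esub> \<otimes>\<^bsub>?A\<^esub> x = x" if "x \<in> carrier ?A" for x
      using that by (induction rule: monoid_alg_induct) (simp_all add: monoid_alg_linearity monoid_alg_simps(2))
    show "x \<otimes>\<^bsub>?A\<^esub> \<one>\<^bsub>?A\<^esub> = x" if "x \<in> carrier ?A" for x
      using that by (induction rule: monoid_alg_induct) (simp_all add: monoid_alg_linearity monoid_alg_simps(2))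
    show "x \<oplus>\<^bsub>?A\<^esub> y \<in> carrier ?A" if "x \<in> carrier ?A" "y \<in> carrier ?A" for x y
      using that by (simp add: monoid_alg_simps(4) monoid_alg_add_closed)
    show "(x \<otimes>\<^bsub>?A\<^esub> y) \<otimes>\<^bsub>?A\<^esub> z = x \<otimes>\<^bsub>?A\<^esub> (y \<otimes>\<^bsub>?A\<^esub> z)"
      if "x \<in> carrier ?A" "y \<in> carrier ?A" "z \<in> carrier ?A" for x y z
      using that by (rule assoc)
    show "x \<otimes>\<^bsub>?A\<^esub> y \<in> carrier ?A" if "x \<in> carrier ?A" "y \<in> carrier ?A" for x y
      using that by (rule mult_closed)
  qed (simp_all add: monoid_alg_linearity monoid_alg_simps ac_simps)
  show ?thesis
  proof (intro star_algebra.intro star_algebra_axioms.intro ring)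
    show "c \<odot>\<^bsub>?A\<^esub> x \<in> carrier ?A" if "x \<in> carrier ?A" for c x
      using that keys_smult_monoid_alg[of M \<tau> c x] by (auto simp: monoid_alg_simps)
    show "(c \<odot>\<^bsub>?A\<^esub> x) \<otimes>\<^bsub>?A\<^esub> y = c \<odot>\<^bsub>?A\<^esub> (x \<otimes>\<^bsub>?A\<^esub> y)"
      if x: "x \<in> carrier ?A" and y: "y \<in> carrier ?A" for c x y
      using x
    proof (induction rule: monoid_alg_induct)
      case (single k a)
      show ?case using y
        by (induction rule: monoid_alg_induct) (simp_all add: monoid_alg_linearity mult.assoc)
    qed (simp_all add: monoid_alg_linearity)
    show "x \<otimes>\<^bsub>?A\<^esub> (c \<odot>\<^bsub>?A\<^esub> y) = c \<odot>\<^bsub>?A\<^esub> (x \<otimes>\<^bsub>?A\<^esub> y)"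
      if x: "x \<in> carrier ?A" and y: "y \<in> carrier ?A" for c x y
      using x
    proof (induction rule: monoid_alg_induct)
      case (single k a)
      show ?case using y
        by (induction rule: monoid_alg_induct) (simp_all add: monoid_alg_linearity mult.left_commute)
    qed (simp_all add: monoid_alg_linearity)
    show "star ?A x \<in> carrier ?A" if "x \<in> carrier ?A" for x
      using that by (induction rule: monoid_alg_induct)
        (simp_all add: monoid_alg_linearity monoid_alg_add_closed single_in_monoid_alg closed,
         simp add: monoid_alg_simps)
    show "star ?A (c \<odot>\<^bsub>?A\<^esub> x) = cnj c \<odot>\<^bsub>?A\<^esub> star ?A x" if "x \<in> carrier ?A" for c x
      using that by (induction rule: monoid_alg_induct) (simp_all add: monoid_alg_linearity)
    show "star ?A (star ?A x) = x" if "x \<in> carrier ?A" for x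
      using that by (induction rule: monoid_alg_induct) (simp_all add: monoid_alg_linearity invol)
    show "star ?A (x \<otimes>\<^bsub>?A\<^esub> y) = star ?A y \<otimes>\<^bsub>?A\<^esub> star ?A x"
      if x: "x \<in> carrier ?A" and y: "y \<in> carrier ?A" for x y
      using x
    proof (induction rule: monoid_alg_induct)
      case (single k a)
      note k = this
      show ?case using y
        by (induction rule: monoid_alg_induct) (simp_all add: monoid_alg_linearity anti k mult.commute)
    qed (simp_all add: monoid_alg_linearity)
  qed (auto simp: monoid_alg_linearity monoid_alg_simps intro!: poly_mapping_eqI
      simp: lookup_smult_monoid_alg lookup_add algebra_simps)
qed

section \<open>Linear extension from a monoid to its algebra\<close>

text \<open>
  The sum that defines the extension ranges over the support of the argument.  Additivity and
  homogeneity compare elements with different supports, so it is convenient to let the sum range over a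
  common larger set.
\<close>

lemma lin_ext_superset:
  assumes B: "star_algebra B" and \<phi>: "\<And>k. k \<in> carrier M \<Longrightarrow> \<phi> k \<in> carrier B"
    and S: "finite S" "Poly_Mapping.keys x \<subseteq> S" "S \<subseteq> carrier M"
  shows "lin_ext B \<phi> x = (\<Oplus>\<^bsub>B\<^esub>k\<in>S. Poly_Mapping.lookup x k \<odot>\<^bsub>B\<^esub> \<phi> k)"
proof -
  interpret B: star_algebra B by fact
  show ?thesis
    unfolding lin_ext_def
    by (rule B.add.finprod_mono_neutral_cong_left)
      (use S \<phi> in \<open>auto simp: in_keys_iff B.smult_zero_left B.smult_closed\<close>)
qed

lemma lin_ext_lin_map:
  assumes B: "star_algebra B" and \<phi>: "\<And>k. k \<in> carrier M \<Longrightarrow> \<phi> k \<in> carrier B"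
  shows "lin_ext B \<phi> \<in> lin_map (monoid_alg M \<tau>) B"
proof -
  interpret B: star_algebra B by fact
  let ?A = "monoid_alg M \<tau>"
  show ?thesis
  proof (rule lin_mapI)
    fix x assume x: "x \<in> carrier ?A"
    then show "lin_ext B \<phi> x \<in> carrier B"
      unfolding lin_ext_def
      by (intro B.finsum_closed) (auto simp: monoid_alg_simps \<phi> B.smult_closed)
    show "lin_ext B \<phi> (c \<odot>\<^bsub>?A\<^esub> x) = c \<odot>\<^bsub>B\<^esub> lin_ext B \<phi> x" for c
    proof -
      let ?S = "Poly_Mapping.keys x"
      have fin: "T \<subseteq> carrier M \<Longrightarrow>
        (\<Oplus>\<^bsub>B\<^esub>k\<in>T. (c * Poly_Mapping.lookup x k) \<odot>\<^bsub>B\<^esub> \<phi> k) =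
          c \<odot>\<^bsub>B\<^esub> (\<Oplus>\<^bsub>B\<^esub>k\<in>T. Poly_Mapping.lookup x k \<odot>\<^bsub>B\<^esub> \<phi> k)" if "finite T" for T
        using that
      proof (induction T)
        case (insert k T)
        then show ?case
          by (subst (1 2) B.finsum_insert)
            (auto simp: Pi_iff B.smult_closed \<phi> subset_iff B.smult_r_distr B.smult_assoc
              intro!: B.finsum_closed)
      qed (simp add: B.smult_zero_right)
      have "lin_ext B \<phi> (c \<odot>\<^bsub>?A\<^esub> x) = (\<Oplus>\<^bsub>B\<^esub>k\<in>?S. (c * Poly_Mapping.lookup x k) \<odot>\<^bsub>B\<^esub> \<phi> k)"
        using x keys_smult_monoid_alg[of M \<tau> c x]
        by (subst lin_ext_superset[OF B, of M _ ?S])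
          (auto simp: \<phi> monoid_alg_simps lookup_smult_monoid_alg)
      with fin[of ?S] x show ?thesis
        by (simp add: monoid_alg_simps lin_ext_def)
    qed
  next
    fix x y assume xy: "x \<in> carrier ?A" "y \<in> carrier ?A"
    let ?S = "Poly_Mapping.keys x \<union> Poly_Mapping.keys y"
    have S: "finite ?S" "?S \<subseteq> carrier M" using xy by (auto simp: monoid_alg_simps)
    note ext = lin_ext_superset[where \<phi> = \<phi>, OF B \<phi> S(1) _ S(2)]
    have "lin_ext B \<phi> (x + y) = (\<Oplus>\<^bsub>B\<^esub>k\<in>?S. Poly_Mapping.lookup (x + y) k \<odot>\<^bsub>B\<^esub> \<phi> k)"
      by (rule ext[OF _ keys_add])
    also have "\<dots> =
        (\<Oplus>\<^bsub>B\<^esub>k\<in>?S. Poly_Mapping.lookup x k \<odot>\<^bsub>B\<^esub> \<phi> k \<oplus>\<^bsub>B\<^esub> Poly_Mapping.lookup y k \<odot>\<^bsub>B\<^esub> \<phi> k)"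
      by (rule B.finsum_cong')
        (use S in \<open>auto simp: lookup_add B.smult_l_distr \<phi> subset_iff B.smult_closed\<close>)
    also have "\<dots> = lin_ext B \<phi> x \<oplus>\<^bsub>B\<^esub> lin_ext B \<phi> y"
      by (subst (1 2) ext)
        (use S in \<open>auto intro!: B.finsum_addf simp: \<phi> subset_iff B.smult_closed\<close>)
    finally show "lin_ext B \<phi> (x \<oplus>\<^bsub>?A\<^esub> y) = lin_ext B \<phi> x \<oplus>\<^bsub>B\<^esub> lin_ext B \<phi> y"
      by (simp add: monoid_alg_simps)
  qed
qed

lemma lin_ext_single:
  assumes B: "star_algebra B" and \<phi>: "\<phi> k \<in> carrier B"
  shows "lin_ext B \<phi> (Poly_Mapping.single k a) = a \<odot>\<^bsub>B\<^esub> \<phi> k"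
proof -
  interpret B: star_algebra B by fact
  show ?thesis
    using \<phi> by (auto simp: lin_ext_def B.smult_zero_left B.smult_closed)
qed

lemma lin_map_eqI_monoid_alg:
  assumes A: "star_algebra (monoid_alg M \<tau>)" and B: "star_algebra B"
    and f: "f \<in> lin_map (monoid_alg M \<tau>) B" and g: "g \<in> lin_map (monoid_alg M \<tau>) B"
    and eq: "\<And>k. k \<in> carrier M \<Longrightarrow> f (Poly_Mapping.single k 1) = g (Poly_Mapping.single k 1)"
    and x: "x \<in> carrier (monoid_alg M \<tau>)"
  shows "f x = g x"
  using x
proof (induction rule: monoid_alg_induct)
  case zero
  then show ?case using lin_map_zero[OF A B f] lin_map_zero[OF A B g] by (simp add: monoid_alg_simps)
next
  case (add x y)
  then show ?case using lin_map_add[OF f, of x y] lin_map_add[OF g, of x y] by (simp add: monoid_alg_simps(4))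
next
  case (single k a)
  then show ?case
    using lin_map_smult[OF f, of "Poly_Mapping.single k 1" a] lin_map_smult[OF g, of "Poly_Mapping.single k 1" a] eq
    by (simp add: single_in_monoid_alg smult_single_monoid_alg)
qed

text \<open>
  Multiplicativity compares two bilinear maps; fixing one argument at a time reduces it to monomials,
  where it is the assumption on \<open>\<phi>\<close>.
\<close>

lemma lin_ext_alg_hom:
  assumes M: "Group.monoid M" and A: "star_algebra (monoid_alg M \<tau>)" and B: "star_algebra B"
    and \<phi>: "\<And>k. k \<in> carrier M \<Longrightarrow> \<phi> k \<in> carrier B"
    and mult: "\<And>k l. k \<in> carrier M \<Longrightarrow> l \<in> carrier M \<Longrightarrow> \<phi> (k \<otimes>\<^bsub>M\<^esub> l) = \<phi> k \<otimes>\<^bsub>B\<^esub> \<phi> l"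
    and one: "\<phi> \<one>\<^bsub>M\<^esub> = \<one>\<^bsub>B\<^esub>"
  shows "lin_ext B \<phi> \<in> alg_hom (monoid_alg M \<tau>) B"
proof (rule alg_homI)
  let ?A = "monoid_alg M \<tau>"
  interpret M: Group.monoid M by fact
  interpret A: star_algebra ?A by fact
  interpret B: star_algebra B by fact
  note single = lin_ext_single[where \<phi> = \<phi>, OF B \<phi>]
  show lin: "lin_ext B \<phi> \<in> lin_map ?A B"
    by (rule lin_ext_lin_map[OF B \<phi>])
  show "lin_ext B \<phi> \<one>\<^bsub>?A\<^esub> = \<one>\<^bsub>B\<^esub>"
    by (simp add: monoid_alg_simps single one B.smult_one)
  fix x y assume x: "x \<in> carrier ?A" and y: "y \<in> carrier ?A"
  show "lin_ext B \<phi> (x \<otimes>\<^bsub>?A\<^esub> y) = lin_ext B \<phi> x \<otimes>\<^bsub>B\<^esub> lin_ext B \<phi> y"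
  proof (rule lin_map_eqI_monoid_alg[OF A B _ _ _ x])
    show "(\<lambda>x. lin_ext B \<phi> (x \<otimes>\<^bsub>?A\<^esub> y)) \<in> lin_map ?A B"
      using lin_map_comp[OF lin_map_mult_right[OF A y] lin] .
    show "(\<lambda>x. lin_ext B \<phi> x \<otimes>\<^bsub>B\<^esub> lin_ext B \<phi> y) \<in> lin_map ?A B"
      using lin_map_comp[OF lin lin_map_mult_right[OF B lin_map_closed[OF lin y]]] .
    fix k assume k: "k \<in> carrier M"
    note sk = single_in_monoid_alg[OF k]
    show "lin_ext B \<phi> (Poly_Mapping.single k 1 \<otimes>\<^bsub>?A\<^esub> y) =
        lin_ext B \<phi> (Poly_Mapping.single k 1) \<otimes>\<^bsub>B\<^esub> lin_ext B \<phi> y"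
    proof (rule lin_map_eqI_monoid_alg[OF A B _ _ _ y])
      show "(\<lambda>y. lin_ext B \<phi> (Poly_Mapping.single k 1 \<otimes>\<^bsub>?A\<^esub> y)) \<in> lin_map ?A B"
        using lin_map_comp[OF lin_map_mult_left[OF A sk] lin] .
      show "(\<lambda>y. lin_ext B \<phi> (Poly_Mapping.single k 1) \<otimes>\<^bsub>B\<^esub> lin_ext B \<phi> y) \<in> lin_map ?A B"
        using lin_map_comp[OF lin lin_map_mult_left[OF B lin_map_closed[OF lin sk]]] .
    qed (simp add: monoid_alg_linearity single k mult \<phi> B.smult_one)
  qed
qed

lemma lin_ext_star:
  assumes B: "star_algebra B"
    and A: "star_algebra (monoid_alg M \<tau>)"
    and \<phi>: "\<And>k. k \<in> carrier M \<Longrightarrow> \<phi> k \<in> carrier B"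
    and \<tau>: "\<And>k. k \<in> carrier M \<Longrightarrow> \<tau> k \<in> carrier M"
    and star: "\<And>k. k \<in> carrier M \<Longrightarrow> \<phi> (\<tau> k) = star B (\<phi> k)"
    and x: "x \<in> carrier (monoid_alg M \<tau>)"
  shows "lin_ext B \<phi> (star (monoid_alg M \<tau>) x) = star B (lin_ext B \<phi> x)"
proof -
  let ?A = "monoid_alg M \<tau>"
  interpret A: star_algebra ?A by fact
  interpret B: star_algebra B by fact
  have lin: "lin_ext B \<phi> \<in> lin_map ?A B" by (rule lin_ext_lin_map[OF B \<phi>])
  note lin' = lin_mapD[OF lin, unfolded monoid_alg_simps(4)]
  have z: "lin_ext B \<phi> 0 = \<zero>\<^bsub>B\<^esub>" by (simp add: lin_ext_def)
  show ?thesis using x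
  proof (induction rule: monoid_alg_induct)
    case (add x y)
    then show ?case
      by (simp add: monoid_alg_linearity lin' A.star_closed B.star_add)
  next
    case (single k a)
    then show ?case
      by (simp add: monoid_alg_linearity lin_ext_single[OF B] \<phi> \<tau> star B.star_closed B.star_smult)
  qed (simp add: z star_zero_monoid_alg B.star_zero)
qed

section \<open>Quotients by ideals closed under the involution\<close>

locale star_ideal = star_algebra A + ideal I A for A :: "('a, 'm) star_alg_scheme" (structure) and I +
  assumes star_ideal_closed: "x \<in> I \<Longrightarrow> star A x \<in> I"
begin

lemma coset_eq_iff:
  assumes "x \<in> carrier A" "y \<in> carrier A"
  shows "I +> x = I +> y \<longleftrightarrow> x \<ominus> y \<in> I"
  using assms a_rcos_self[of x] a_repr_independence'[of x y] a_rcos_module_minus[OF ring_axioms, of y x]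
  by auto

lemma coset_subset: "x \<in> carrier A \<Longrightarrow> I +> x \<subseteq> carrier A"
  by (simp add: a_r_coset_subset_G a_subset)

text \<open>
  The quotient operations are unions over all representatives of a coset.  For an operation that respects
  congruence modulo the ideal, all members of this union coincide.
\<close>

lemma UN_coset:
  assumes closed: "\<And>x. x \<in> carrier A \<Longrightarrow> f x \<in> carrier A"
    and diff: "\<And>x y. x \<in> carrier A \<Longrightarrow> y \<in> carrier A \<Longrightarrow> x \<ominus> y \<in> I \<Longrightarrow> f x \<ominus> f y \<in> I"
    and x: "x \<in> carrier A"
  shows "(\<Union>y\<in>I +> x. I +> f y) = I +> f x"
proof -
  have "I +> f y = I +> f x" if y: "y \<in> I +> x" for y
  proof -
    have yc: "y \<in> carrier A" using coset_subset[OF x] y by auto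
    have "y \<ominus> x \<in> I"
      using y a_rcos_module_minus[OF ring_axioms x yc] by simp
    then show ?thesis
      using coset_eq_iff[OF closed closed] diff x yc by simp
  qed
  then show ?thesis using a_rcos_self[OF x] by blast
qed

lemma smult_coset:
  assumes x: "x \<in> carrier A"
  shows "c \<odot>\<^bsub>quot_alg A I\<^esub> (I +> x) = I +> c \<odot> x"
proof -
  have "c \<odot> y \<ominus> c \<odot> z = c \<odot> (y \<ominus> z)" if "y \<in> carrier A" "z \<in> carrier A" for y z
    using that lin_map_minus[OF star_algebra_axioms star_algebra_axioms
      lin_map_smult_map[OF star_algebra_axioms]] by simp
  then show ?thesis
    using UN_coset[of "\<lambda>y. c \<odot> y" x] x ideal_smult_closed[OF ideal_axioms] smult_closed
    by (simp add: quot_alg_def)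
qed

lemma star_coset:
  assumes x: "x \<in> carrier A"
  shows "star (quot_alg A I) (I +> x) = I +> star A x"
proof -
  have "star A y \<ominus> star A z = star A (y \<ominus> z)" if "y \<in> carrier A" "z \<in> carrier A" for y z
    using that by (simp add: a_minus_def a_inv_smult star_add star_smult smult_closed star_closed)
  then show ?thesis
    using UN_coset[of "star A" x] x star_ideal_closed star_closed
    by (simp add: quot_alg_def)
qed

lemma add_coset:
  "x \<in> carrier A \<Longrightarrow> y \<in> carrier A \<Longrightarrow> (I +> x) \<oplus>\<^bsub>quot_alg A I\<^esub> (I +> y) = I +> (x \<oplus> y)"
  by (simp add: quot_alg_def FactRing_def a_rcos_sum)

lemma mult_coset:
  "x \<in> carrier A \<Longrightarrow> y \<in> carrier A \<Longrightarrow> (I +> x) \<otimes>\<^bsub>quot_alg A I\<^esub> (I +> y) = I +> (x \<otimes> y)"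
  by (simp add: quot_alg_def FactRing_def rcoset_mult_add)

lemma one_coset: "\<one>\<^bsub>quot_alg A I\<^esub> = I +> \<one>"
  by (simp add: quot_alg_def FactRing_def)

lemma zero_coset: "\<zero>\<^bsub>quot_alg A I\<^esub> = I +> \<zero>"
  by (simp add: quot_alg_def FactRing_def a_subset)

lemma carrier_quot_alg: "carrier (quot_alg A I) = (\<lambda>x. I +> x) ` carrier A"
  by (auto simp: quot_alg_def FactRing_def A_RCOSETS_def')

lemmas coset_simps = smult_coset star_coset add_coset mult_coset one_coset zero_coset

lemma quot_alg_star_algebra: "star_algebra (quot_alg A I)"
proof (intro star_algebra.intro star_algebra_axioms.intro ringI abelian_groupI monoidI)
  let ?Q = "quot_alg A I"
  show "\<exists>Y\<in>carrier ?Q. Y \<oplus>\<^bsub>?Q\<^esub> X = \<zero>\<^bsub>?Q\<^esub>" if X: "X \<in> carrier ?Q" for X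
  proof -
    obtain x where x: "x \<in> carrier A" "X = I +> x" using X by (auto simp: carrier_quot_alg)
    then have "(I +> \<ominus> x) \<oplus>\<^bsub>?Q\<^esub> X = \<zero>\<^bsub>?Q\<^esub>" by (simp add: coset_simps l_neg)
    with x show ?thesis by (intro bexI[of _ "I +> \<ominus> x"]) (auto simp: carrier_quot_alg)
  qed
qed (auto simp: carrier_quot_alg coset_simps smult_closed star_closed a_ac m_assoc l_distr r_distr
    smult_l_distr smult_r_distr smult_assoc smult_one smult_mult_left smult_mult_right
    star_add star_smult star_mult star_star)

lemma coset_alg_hom: "(\<lambda>x. I +> x) \<in> alg_hom A (quot_alg A I)"
  by (intro alg_homI lin_mapI) (auto simp: carrier_quot_alg coset_simps)

text \<open>
  A linear map that vanishes on the ideal is constant on each coset, so its image of a coset is a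
  singleton.
\<close>

lemma the_elem_coset:
  assumes B: "star_algebra B" and f: "f \<in> lin_map A B"
    and vanish: "\<And>x. x \<in> I \<Longrightarrow> f x = \<zero>\<^bsub>B\<^esub>" and x: "x \<in> carrier A"
  shows "the_elem (f ` (I +> x)) = f x"
proof -
  interpret B: star_algebra B by fact
  have "f (h \<oplus> x) = f x" if "h \<in> I" for h
    using that x f vanish by (simp add: lin_mapD a_Hcarr)
  then have "f ` (I +> x) = {f x}"
    using zero_closed x additive_subgroup.zero_closed[OF is_additive_subgroup]
    by (auto simp: a_r_coset_def' image_iff)
  then show ?thesis by simp
qed

lemma lin_map_quot_alg:
  assumes "star_algebra B" "f \<in> lin_map A B" "\<And>x. x \<in> I \<Longrightarrow> f x = \<zero>\<^bsub>B\<^esub>"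
  shows "(\<lambda>X. the_elem (f ` X)) \<in> lin_map (quot_alg A I) B"
  by (rule lin_mapI)
    (auto simp: carrier_quot_alg coset_simps the_elem_coset[OF assms] lin_mapD[OF assms(2)] smult_closed)

lemma alg_hom_quot_alg:
  assumes B: "star_algebra B" and f: "f \<in> alg_hom A B" and vanish: "\<And>x. x \<in> I \<Longrightarrow> f x = \<zero>\<^bsub>B\<^esub>"
  shows "(\<lambda>X. the_elem (f ` X)) \<in> alg_hom (quot_alg A I) B"
  by (rule alg_homI[OF lin_map_quot_alg[OF B alg_hom_lin[OF f] vanish]])
    (auto simp: carrier_quot_alg coset_simps the_elem_coset[OF B alg_hom_lin[OF f] vanish] alg_homD[OF f])

end

section \<open>Spans\<close>

lemma lin_span_subset:
  assumes A: "star_algebra A" and S: "S \<subseteq> carrier A"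
  shows "lin_span A S \<subseteq> carrier A"
proof
  interpret star_algebra A by fact
  show "x \<in> carrier A" if "x \<in> lin_span A S" for x
    using that by induction (use S in \<open>auto simp: smult_closed\<close>)
qed

text \<open>
  Products and adjoints are (anti)linear, so absorption and stability under the involution need to be
  checked only on the spanning set.
\<close>

lemma lin_span_star_ideal:
  assumes A: "star_algebra A" and S: "S \<subseteq> carrier A"
    and left: "\<And>x y. x \<in> S \<Longrightarrow> y \<in> carrier A \<Longrightarrow> y \<otimes>\<^bsub>A\<^esub> x \<in> lin_span A S"
    and right: "\<And>x y. x \<in> S \<Longrightarrow> y \<in> carrier A \<Longrightarrow> x \<otimes>\<^bsub>A\<^esub> y \<in> lin_span A S"
    and star: "\<And>x. x \<in> S \<Longrightarrow> star A x \<in> lin_span A S"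
  shows "star_ideal A (lin_span A S)"
proof -
  interpret star_algebra A by fact
  let ?I = "lin_span A S"
  have sub: "?I \<subseteq> carrier A" by (rule lin_span_subset[OF A S])
  show ?thesis
  proof (intro star_ideal.intro star_ideal_axioms.intro A idealI ring_axioms subgroup.intro)
    show "inv\<^bsub>add_monoid A\<^esub> x \<in> ?I" if "x \<in> ?I" for x
      using that sub a_inv_smult[of x] lin_span.smult[of x A S "- 1"] by (auto simp: a_inv_def)
    show "y \<otimes>\<^bsub>A\<^esub> x \<in> ?I" if "x \<in> ?I" "y \<in> carrier A" for x y
      using that
    proof (induction rule: lin_span.induct)
      case (add u v)
      then show ?case using sub by (simp add: r_distr subsetD lin_span.add)
    next
      case (smult u c)
      then show ?case using sub by (simp add: smult_mult_right subsetD lin_span.smult)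
    qed (auto simp: left lin_span.zero)
    show "x \<otimes>\<^bsub>A\<^esub> y \<in> ?I" if "x \<in> ?I" "y \<in> carrier A" for x y
      using that
    proof (induction rule: lin_span.induct)
      case (add u v)
      then show ?case using sub by (simp add: l_distr subsetD lin_span.add)
    next
      case (smult u c)
      then show ?case using sub by (simp add: smult_mult_left subsetD lin_span.smult)
    qed (auto simp: right lin_span.zero)
    show "star A x \<in> ?I" if "x \<in> ?I" for x
      using that
    proof (induction rule: lin_span.induct)
      case (add u v)
      then show ?case using sub by (simp add: star_add subsetD lin_span.add)
    next
      case (smult u c)
      then show ?case using sub by (simp add: star_smult subsetD lin_span.smult)
    qed (auto simp: star lin_span.zero star_zero)
  qed (use sub in \<open>auto intro: lin_span.add lin_span.zero\<close>)
qed

section \<open>Tensor products\<close>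

lemma diff_monoid_alg:
  "z \<otimes>\<^bsub>monoid_alg M \<tau>\<^esub> (x - y) = z \<otimes>\<^bsub>monoid_alg M \<tau>\<^esub> x - z \<otimes>\<^bsub>monoid_alg M \<tau>\<^esub> y"
  "(x - y) \<otimes>\<^bsub>monoid_alg M \<tau>\<^esub> z = x \<otimes>\<^bsub>monoid_alg M \<tau>\<^esub> z - y \<otimes>\<^bsub>monoid_alg M \<tau>\<^esub> z"
  "star (monoid_alg M \<tau>) (x - y) = star (monoid_alg M \<tau>) x - star (monoid_alg M \<tau>) y"
  "c \<odot>\<^bsub>monoid_alg M \<tau>\<^esub> (x - y) = c \<odot>\<^bsub>monoid_alg M \<tau>\<^esub> x - c \<odot>\<^bsub>monoid_alg M \<tau>\<^esub> y"
  using mult_add_right_monoid_alg[of M \<tau> z "x - y" y] mult_add_left_monoid_alg[of M \<tau> "x - y" y z]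
    star_add_monoid_alg[of M \<tau> "x - y" y] smult_add_monoid_alg[where M = M and \<tau> = \<tau> and c = c and x = "x - y" and y = y]
  by simp_all

lemma diff_closed_monoid_alg:
  "x \<in> carrier (monoid_alg M \<tau>) \<Longrightarrow> y \<in> carrier (monoid_alg M \<tau>) \<Longrightarrow> x - y \<in> carrier (monoid_alg M \<tau>)"
  using keys_diff[of x y] by (auto simp: monoid_alg_simps)

lemma minus_monoid_alg:
  assumes "star_algebra (monoid_alg M \<tau>)"
    and x: "x \<in> carrier (monoid_alg M \<tau>)" and y: "y \<in> carrier (monoid_alg M \<tau>)"
  shows "x \<ominus>\<^bsub>monoid_alg M \<tau>\<^esub> y = x - y"
proof -
  interpret star_algebra "monoid_alg M \<tau>" by fact
  have "(x - y) \<oplus>\<^bsub>monoid_alg M \<tau>\<^esub> y = x" by (simp add: monoid_alg_simps)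
  then have "x \<ominus>\<^bsub>monoid_alg M \<tau>\<^esub> y = ((x - y) \<oplus>\<^bsub>monoid_alg M \<tau>\<^esub> y) \<ominus>\<^bsub>monoid_alg M \<tau>\<^esub> y" by simp
  also have "\<dots> = x - y"
    using diff_closed_monoid_alg[OF x y] y by (simp add: a_minus_def a_assoc r_neg)
  finally show ?thesis .
qed

lemma formal_tensors_star_algebra:
  assumes "star_algebra A" "star_algebra B"
  shows "star_algebra (formal_tensors A B)"
proof -
  interpret A: star_algebra A by fact
  interpret B: star_algebra B by fact
  show ?thesis
    unfolding formal_tensors_def
    by (rule monoid_alg_star_algebra)
      (auto simp: DirProd_monoid A.monoid_axioms B.monoid_axioms A.star_closed B.star_closed
        A.star_star B.star_star A.star_mult B.star_mult)
qed

lemma bilinear_rels_closed: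
  assumes "star_algebra A" "star_algebra B"
  shows "bilinear_rels A B \<subseteq> carrier (formal_tensors A B)"
proof
  interpret A: star_algebra A by fact
  interpret B: star_algebra B by fact
  show "x \<in> carrier (formal_tensors A B)" if "x \<in> bilinear_rels A B" for x
    using that
    by induction (auto simp: formal_tensors_def A.smult_closed B.smult_closed
        intro!: diff_closed_monoid_alg monoid_alg_add_closed single_in_monoid_alg)
qed

text \<open>
  Multiplying a bilinearity relation by a monomial gives a scalar multiple of a bilinearity relation of
  the same kind, with the factors multiplied; general multipliers are sums of monomials.  The adjoint of a
  bilinearity relation is again one, with conjugate scalar.
\<close>

lemma tensor_null_star_ideal:
  fixes A :: "('a, 'm) star_alg_scheme" and B :: "('b, 'n) star_alg_scheme"
  assumes A: "star_algebra A" and B: "star_algebra B"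
  shows "star_ideal (formal_tensors A B) (tensor_null A B)"
  unfolding tensor_null_def
proof (rule lin_span_star_ideal[OF formal_tensors_star_algebra[OF A B] bilinear_rels_closed[OF A B]])
  interpret A: star_algebra A by fact
  interpret B: star_algebra B by fact
  let ?F = "formal_tensors A B"
  let ?N = "lin_span ?F (bilinear_rels A B)"
  have add: "x + y \<in> ?N" if "x \<in> ?N" "y \<in> ?N" for x y
    using lin_span.add[OF that] by (simp add: formal_tensors_def monoid_alg_simps)
  have zero: "0 \<in> ?N"
    using lin_span.zero[of ?F] by (simp add: formal_tensors_def monoid_alg_simps)
  have base1: "x \<in> ?N" if "x \<in> bilinear_rels A B" for x
    using that by (rule lin_span.base)
  have base: "k \<odot>\<^bsub>?F\<^esub> x \<in> ?N" if "x \<in> bilinear_rels A B" for k x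
    using that by (intro lin_span.smult lin_span.base)
  note lin = formal_tensors_def diff_monoid_alg monoid_alg_linearity
  show "y \<otimes>\<^bsub>?F\<^esub> x \<in> ?N" if x: "x \<in> bilinear_rels A B" and y: "y \<in> carrier ?F" for x y
    using y[unfolded formal_tensors_def]
  proof (induction rule: monoid_alg_induct)
    case (single ab k)
    obtain u v where uv: "ab = (u, v)" "u \<in> carrier A" "v \<in> carrier B"
      using single by (cases ab) auto
    show ?case using x
    proof cases
      case (add_left a a' b)
      then show ?thesis
        using base[OF bilinear_rels.add_left[of "u \<otimes>\<^bsub>A\<^esub> a" A "u \<otimes>\<^bsub>A\<^esub> a'" "v \<otimes>\<^bsub>B\<^esub> b" B], of k] uv
        by (simp add: lin A.r_distr)
    next
      case (add_right a b b')
      then show ?thesis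
        using base[OF bilinear_rels.add_right[of "u \<otimes>\<^bsub>A\<^esub> a" A "v \<otimes>\<^bsub>B\<^esub> b" B "v \<otimes>\<^bsub>B\<^esub> b'"], of k] uv
        by (simp add: lin B.r_distr)
    next
      case (smult_left a b c)
      then show ?thesis
        using base[OF bilinear_rels.smult_left[where a = "u \<otimes>\<^bsub>A\<^esub> a" and b = "v \<otimes>\<^bsub>B\<^esub> b" and c = c], of k] uv
        by (simp add: lin A.smult_mult_right)
    next
      case (smult_right a b c)
      then show ?thesis
        using base[OF bilinear_rels.smult_right[where a = "u \<otimes>\<^bsub>A\<^esub> a" and b = "v \<otimes>\<^bsub>B\<^esub> b" and c = c], of k] uv
        by (simp add: lin B.smult_mult_right)
    qed
  qed (use add zero in \<open>simp_all add: lin\<close>)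
  show "x \<otimes>\<^bsub>?F\<^esub> y \<in> ?N" if x: "x \<in> bilinear_rels A B" and y: "y \<in> carrier ?F" for x y
    using y[unfolded formal_tensors_def]
  proof (induction rule: monoid_alg_induct)
    case (single ab k)
    obtain u v where uv: "ab = (u, v)" "u \<in> carrier A" "v \<in> carrier B"
      using single by (cases ab) auto
    show ?case using x
    proof cases
      case (add_left a a' b)
      then show ?thesis
        using base[OF bilinear_rels.add_left[of "a \<otimes>\<^bsub>A\<^esub> u" A "a' \<otimes>\<^bsub>A\<^esub> u" "b \<otimes>\<^bsub>B\<^esub> v" B], of k] uv
        by (simp add: lin A.l_distr)
    next
      case (add_right a b b')
      then show ?thesis
        using base[OF bilinear_rels.add_right[of "a \<otimes>\<^bsub>A\<^esub> u" A "b \<otimes>\<^bsub>B\<^esub> v" B "b' \<otimes>\<^bsub>B\<^esub> v"], of k] uv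
        by (simp add: lin B.l_distr)
    next
      case (smult_left a b c)
      then show ?thesis
        using base[OF bilinear_rels.smult_left[where a = "a \<otimes>\<^bsub>A\<^esub> u" and b = "b \<otimes>\<^bsub>B\<^esub> v" and c = c], of k] uv
        by (simp add: lin A.smult_mult_left mult.commute)
    next
      case (smult_right a b c)
      then show ?thesis
        using base[OF bilinear_rels.smult_right[where a = "a \<otimes>\<^bsub>A\<^esub> u" and b = "b \<otimes>\<^bsub>B\<^esub> v" and c = c], of k] uv
        by (simp add: lin B.smult_mult_left mult.commute)
    qed
  qed (use add zero in \<open>simp_all add: lin\<close>)
  show "star ?F x \<in> ?N" if x: "x \<in> bilinear_rels A B" for x
    using x
  proof cases
    case (add_left a a' b)
    then show ?thesis
      using base1[OF bilinear_rels.add_left[of "star A a" A "star A a'" "star B b" B]]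
      by (simp add: lin A.star_add A.star_closed B.star_closed)
  next
    case (add_right a b b')
    then show ?thesis
      using base1[OF bilinear_rels.add_right[of "star A a" A "star B b" B "star B b'"]]
      by (simp add: lin B.star_add A.star_closed B.star_closed)
  next
    case (smult_left a b c)
    then show ?thesis
      using base1[OF bilinear_rels.smult_left[where a = "star A a" and b = "star B b" and c = "cnj c"]]
      by (simp add: lin A.star_smult A.star_closed B.star_closed)
  next
    case (smult_right a b c)
    then show ?thesis
      using base1[OF bilinear_rels.smult_right[where a = "star A a" and b = "star B b" and c = "cnj c"]]
      by (simp add: lin B.star_smult A.star_closed B.star_closed)
  qed
qed

lemma tensor_alg_star_algebra:
  "star_algebra A \<Longrightarrow> star_algebra B \<Longrightarrow> star_algebra (tensor_alg A B)"
  unfolding tensor_alg_def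
  by (intro star_ideal.quot_alg_star_algebra tensor_null_star_ideal)

context
  fixes A :: "('a, 'm) star_alg_scheme" and B :: "('b, 'n) star_alg_scheme"
  assumes A: "star_algebra A" and B: "star_algebra B"
begin

interpretation A: star_algebra A by (rule A)
interpretation B: star_algebra B by (rule B)
interpretation N: star_ideal "formal_tensors A B" "tensor_null A B"
  by (rule tensor_null_star_ideal[OF A B])

lemma single_in_formal_tensors:
  "a \<in> carrier A \<Longrightarrow> b \<in> carrier B \<Longrightarrow> Poly_Mapping.single (a, b) c \<in> carrier (formal_tensors A B)"
  by (simp add: formal_tensors_def single_in_monoid_alg)

lemma coset_eqI_formal_tensors:
  assumes "x \<in> carrier (formal_tensors A B)" "y \<in> carrier (formal_tensors A B)" "x - y \<in> bilinear_rels A B"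
  shows "tensor_null A B +>\<^bsub>formal_tensors A B\<^esub> x = tensor_null A B +>\<^bsub>formal_tensors A B\<^esub> y"
proof -
  have "x \<ominus>\<^bsub>formal_tensors A B\<^esub> y = x - y"
    using minus_monoid_alg[of "A \<times>\<times> B" "map_prod (star A) (star B)" x y] assms N.star_algebra_axioms
    by (simp add: formal_tensors_def)
  then show ?thesis
    using assms N.coset_eq_iff[OF assms(1,2)] by (auto simp: tensor_null_def intro: lin_span.base)
qed

lemma tensor_closed: "a \<in> carrier A \<Longrightarrow> b \<in> carrier B \<Longrightarrow> tensor A B a b \<in> carrier (tensor_alg A B)"
  by (simp add: tensor_def tensor_alg_def N.carrier_quot_alg single_in_formal_tensors)

lemma tensor_add_left:
  assumes "a \<in> carrier A" "a' \<in> carrier A" "b \<in> carrier B"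
  shows "tensor A B (a \<oplus>\<^bsub>A\<^esub> a') b = tensor A B a b \<oplus>\<^bsub>tensor_alg A B\<^esub> tensor A B a' b"
proof -
  have "tensor A B (a \<oplus>\<^bsub>A\<^esub> a') b = tensor_null A B +>\<^bsub>formal_tensors A B\<^esub>
      (Poly_Mapping.single (a, b) 1 \<oplus>\<^bsub>formal_tensors A B\<^esub> Poly_Mapping.single (a', b) 1)"
    unfolding tensor_def
    by (rule coset_eqI_formal_tensors)
      (use assms in \<open>auto intro!: single_in_formal_tensors N.a_closed,
        auto simp: formal_tensors_def monoid_alg_simps intro: bilinear_rels.add_left\<close>)
  then show ?thesis
    using assms by (simp add: tensor_def tensor_alg_def N.add_coset single_in_formal_tensors)
qed

lemma tensor_add_right:
  assumes "a \<in> carrier A" "b \<in> carrier B" "b' \<in> carrier B"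
  shows "tensor A B a (b \<oplus>\<^bsub>B\<^esub> b') = tensor A B a b \<oplus>\<^bsub>tensor_alg A B\<^esub> tensor A B a b'"
proof -
  have "tensor A B a (b \<oplus>\<^bsub>B\<^esub> b') = tensor_null A B +>\<^bsub>formal_tensors A B\<^esub>
      (Poly_Mapping.single (a, b) 1 \<oplus>\<^bsub>formal_tensors A B\<^esub> Poly_Mapping.single (a, b') 1)"
    unfolding tensor_def
    by (rule coset_eqI_formal_tensors)
      (use assms in \<open>auto intro!: single_in_formal_tensors N.a_closed,
        auto simp: formal_tensors_def monoid_alg_simps intro: bilinear_rels.add_right\<close>)
  then show ?thesis
    using assms by (simp add: tensor_def tensor_alg_def N.add_coset single_in_formal_tensors)
qed

lemma tensor_smult_left:
  assumes "a \<in> carrier A" "b \<in> carrier B"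
  shows "tensor A B (c \<odot>\<^bsub>A\<^esub> a) b = c \<odot>\<^bsub>tensor_alg A B\<^esub> tensor A B a b"
proof -
  have s: "Poly_Mapping.single (a, b) c = c \<odot>\<^bsub>formal_tensors A B\<^esub> Poly_Mapping.single (a, b) 1"
    by (simp add: formal_tensors_def smult_single_monoid_alg)
  have "tensor A B (c \<odot>\<^bsub>A\<^esub> a) b = tensor_null A B +>\<^bsub>formal_tensors A B\<^esub> Poly_Mapping.single (a, b) c"
    unfolding tensor_def
    by (rule coset_eqI_formal_tensors)
      (use assms in \<open>auto intro!: single_in_formal_tensors A.smult_closed bilinear_rels.smult_left\<close>)
  then show ?thesis
    using assms by (simp add: s tensor_def tensor_alg_def N.smult_coset single_in_formal_tensors)
qed

lemma tensor_smult_right: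
  assumes "a \<in> carrier A" "b \<in> carrier B"
  shows "tensor A B a (c \<odot>\<^bsub>B\<^esub> b) = c \<odot>\<^bsub>tensor_alg A B\<^esub> tensor A B a b"
proof -
  have s: "Poly_Mapping.single (a, b) c = c \<odot>\<^bsub>formal_tensors A B\<^esub> Poly_Mapping.single (a, b) 1"
    by (simp add: formal_tensors_def smult_single_monoid_alg)
  have "tensor A B a (c \<odot>\<^bsub>B\<^esub> b) = tensor_null A B +>\<^bsub>formal_tensors A B\<^esub> Poly_Mapping.single (a, b) c"
    unfolding tensor_def
    by (rule coset_eqI_formal_tensors)
      (use assms in \<open>auto intro!: single_in_formal_tensors B.smult_closed bilinear_rels.smult_right\<close>)
  then show ?thesis
    using assms by (simp add: s tensor_def tensor_alg_def N.smult_coset single_in_formal_tensors)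
qed

lemma tensor_mult:
  assumes "a \<in> carrier A" "b \<in> carrier B" "a' \<in> carrier A" "b' \<in> carrier B"
  shows "tensor A B a b \<otimes>\<^bsub>tensor_alg A B\<^esub> tensor A B a' b' = tensor A B (a \<otimes>\<^bsub>A\<^esub> a') (b \<otimes>\<^bsub>B\<^esub> b')"
  using assms N.mult_coset[of "Poly_Mapping.single (a, b) 1" "Poly_Mapping.single (a', b') 1"]
  by (simp add: tensor_def tensor_alg_def single_in_formal_tensors)
    (simp add: formal_tensors_def mult_single_monoid_alg)

lemma tensor_star:
  assumes "a \<in> carrier A" "b \<in> carrier B"
  shows "star (tensor_alg A B) (tensor A B a b) = tensor A B (star A a) (star B b)"
  using assms N.star_coset[of "Poly_Mapping.single (a, b) 1"]
  by (simp add: tensor_def tensor_alg_def single_in_formal_tensors)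
    (simp add: formal_tensors_def star_single_monoid_alg)

lemma tensor_one: "\<one>\<^bsub>tensor_alg A B\<^esub> = tensor A B \<one>\<^bsub>A\<^esub> \<one>\<^bsub>B\<^esub>"
  by (simp add: tensor_def tensor_alg_def N.one_coset) (simp add: formal_tensors_def monoid_alg_simps)

text \<open>
  Linear maps out of the tensor product become linear maps on formal combinations after composition with
  the coset map, and there they are determined by their values on pairs.
\<close>

lemma lin_map_eqI_tensor_alg:
  assumes C: "star_algebra C" and f: "f \<in> lin_map (tensor_alg A B) C" and g: "g \<in> lin_map (tensor_alg A B) C"
    and eq: "\<And>a b. a \<in> carrier A \<Longrightarrow> b \<in> carrier B \<Longrightarrow> f (tensor A B a b) = g (tensor A B a b)"
    and X: "X \<in> carrier (tensor_alg A B)"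
  shows "f X = g X"
proof -
  obtain x where x: "x \<in> carrier (formal_tensors A B)"
    "X = tensor_null A B +>\<^bsub>formal_tensors A B\<^esub> x"
    using X by (auto simp: tensor_alg_def N.carrier_quot_alg)
  have q: "(\<lambda>x. tensor_null A B +>\<^bsub>formal_tensors A B\<^esub> x) \<in> lin_map (formal_tensors A B) (tensor_alg A B)"
    using alg_hom_lin[OF N.coset_alg_hom] by (simp add: tensor_alg_def)
  have "f (tensor_null A B +>\<^bsub>formal_tensors A B\<^esub> x) = g (tensor_null A B +>\<^bsub>formal_tensors A B\<^esub> x)"
    by (rule lin_map_eqI_monoid_alg[of "A \<times>\<times> B" "map_prod (star A) (star B)" C
        "\<lambda>x. f (tensor_null A B +>\<^bsub>formal_tensors A B\<^esub> x)", folded formal_tensors_def,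
        OF N.star_algebra_axioms C lin_map_comp[OF q f] lin_map_comp[OF q g] _ x(1)])
      (auto simp: eq[unfolded tensor_def])
  with x show ?thesis by simp
qed

end

definition bilinear ::
    "('a, 'm) star_alg_scheme \<Rightarrow> ('b, 'n) star_alg_scheme \<Rightarrow> ('c, 'o) star_alg_scheme \<Rightarrow>
     ('a \<Rightarrow> 'b \<Rightarrow> 'c) \<Rightarrow> bool" where
  "bilinear A B C \<beta> \<longleftrightarrow> (\<forall>b\<in>carrier B. (\<lambda>a. \<beta> a b) \<in> lin_map A C) \<and> (\<forall>a\<in>carrier A. \<beta> a \<in> lin_map B C)"

lemma bilinear_tensor: "star_algebra A \<Longrightarrow> star_algebra B \<Longrightarrow> bilinear A B (tensor_alg A B) (tensor A B)"
  unfolding bilinear_def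
  by (auto intro!: lin_mapI simp: tensor_closed tensor_add_left tensor_add_right tensor_smult_left tensor_smult_right)

lemma bilinear_comp:
  assumes "bilinear C D E \<beta>" "f \<in> lin_map A C" "g \<in> lin_map B D"
  shows "bilinear A B E (\<lambda>a b. \<beta> (f a) (g b))"
  using assms by (auto simp: bilinear_def lin_mapD intro: lin_map_comp)

context
  fixes A :: "('a, 'm) star_alg_scheme" and B :: "('b, 'n) star_alg_scheme"
    and C :: "('c, 'o) star_alg_scheme" and \<beta>
  assumes A: "star_algebra A" and B: "star_algebra B" and C: "star_algebra C"
    and \<beta>: "bilinear A B C \<beta>"
begin

interpretation A: star_algebra A by (rule A)
interpretation B: star_algebra B by (rule B)
interpretation C: star_algebra C by (rule C)
interpretation N: star_ideal "formal_tensors A B" "tensor_null A B"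
  by (rule tensor_null_star_ideal[OF A B])

lemma bilinear_closed: "a \<in> carrier A \<Longrightarrow> b \<in> carrier B \<Longrightarrow> \<beta> a b \<in> carrier C"
  using \<beta> by (auto simp: bilinear_def lin_mapD)

lemma lin_ext_bilinear: "lin_ext C (case_prod \<beta>) \<in> lin_map (formal_tensors A B) C"
  unfolding formal_tensors_def by (rule lin_ext_lin_map[OF C]) (auto simp: bilinear_closed)

text \<open>
  This makes the extension of \<open>\<beta>\<close> constant on cosets: it kills the spanning relations precisely
  because \<open>\<beta>\<close> is bilinear.
\<close>

lemma lin_ext_bilinear_null:
  assumes "x \<in> tensor_null A B"
  shows "lin_ext C (case_prod \<beta>) x = \<zero>\<^bsub>C\<^esub>"
proof -
  let ?F = "formal_tensors A B"
  note lin = lin_mapD[OF lin_ext_bilinear]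
  have \<beta>_left: "\<And>b. b \<in> carrier B \<Longrightarrow> (\<lambda>a. \<beta> a b) \<in> lin_map A C"
    and \<beta>_right: "\<And>a. a \<in> carrier A \<Longrightarrow> \<beta> a \<in> lin_map B C"
    using \<beta> by (auto simp: bilinear_def)
  have diff: "lin_ext C (case_prod \<beta>) (x - y) = lin_ext C (case_prod \<beta>) x \<ominus>\<^bsub>C\<^esub> lin_ext C (case_prod \<beta>) y"
    if "x \<in> carrier ?F" "y \<in> carrier ?F" for x y
    using lin_map_minus[OF N.star_algebra_axioms C lin_ext_bilinear that] that
      minus_monoid_alg[OF N.star_algebra_axioms[unfolded formal_tensors_def]]
    by (simp add: formal_tensors_def)
  have add: "lin_ext C (case_prod \<beta>) (x + y) = lin_ext C (case_prod \<beta>) x \<oplus>\<^bsub>C\<^esub> lin_ext C (case_prod \<beta>) y"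
    "x + y \<in> carrier ?F"
    if "x \<in> carrier ?F" "y \<in> carrier ?F" for x y
    using lin(2)[OF that] monoid_alg_add_closed[OF that[unfolded formal_tensors_def]]
    by (simp_all add: formal_tensors_def monoid_alg_simps(4))
  note single = lin_ext_single[OF C, of "case_prod \<beta>"]
  have rel: "lin_ext C (case_prod \<beta>) x = \<zero>\<^bsub>C\<^esub>" if "x \<in> bilinear_rels A B" for x
    using that
    by cases (simp_all add: diff add single single_in_formal_tensors[OF A B] bilinear_closed
        lin_map_add[OF \<beta>_left] lin_map_add[OF \<beta>_right] lin_map_smult[OF \<beta>_left] lin_map_smult[OF \<beta>_right]
        A.smult_closed B.smult_closed C.smult_closed C.smult_one C.r_neg C.minus_eq)
  have sub: "lin_span ?F (bilinear_rels A B) \<subseteq> carrier ?F"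
    using N.a_subset by (simp add: tensor_null_def)
  from assms show ?thesis
    unfolding tensor_null_def
  proof induction
    case zero
    show ?case using lin_map_zero[OF N.star_algebra_axioms C lin_ext_bilinear] .
  next
    case (add x y)
    then show ?case using sub lin by (simp add: subset_iff)
  next
    case (smult x c)
    then show ?case using sub lin by (simp add: subset_iff C.smult_zero_right)
  qed (rule rel)
qed

lemma tensor_lift_lin_map: "tensor_lift C \<beta> \<in> lin_map (tensor_alg A B) C"
  unfolding tensor_lift_def tensor_alg_def
  by (rule N.lin_map_quot_alg[OF C lin_ext_bilinear lin_ext_bilinear_null])

lemma tensor_lift_tensor:
  assumes "a \<in> carrier A" "b \<in> carrier B"
  shows "tensor_lift C \<beta> (tensor A B a b) = \<beta> a b"
  using assms
  by (simp add: tensor_lift_def tensor_def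
      N.the_elem_coset[OF C lin_ext_bilinear lin_ext_bilinear_null] single_in_formal_tensors[OF A B]
      lin_ext_single[OF C] bilinear_closed C.smult_one)

end

lemma tensor_map:
  assumes "star_algebra A" "star_algebra B" "star_algebra C" "star_algebra D"
    and "f \<in> lin_map A C" "g \<in> lin_map B D"
  shows tensor_map_lin_map: "tensor_map C D f g \<in> lin_map (tensor_alg A B) (tensor_alg C D)"
    and tensor_map_tensor: "a \<in> carrier A \<Longrightarrow> b \<in> carrier B \<Longrightarrow>
      tensor_map C D f g (tensor A B a b) = tensor C D (f a) (g b)"
  using tensor_lift_lin_map[OF assms(1,2) tensor_alg_star_algebra[OF assms(3,4)]
      bilinear_comp[OF bilinear_tensor[OF assms(3,4)] assms(5,6)]]
    tensor_lift_tensor[OF assms(1,2) tensor_alg_star_algebra[OF assms(3,4)]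
      bilinear_comp[OF bilinear_tensor[OF assms(3,4)] assms(5,6)]]
  by (auto simp: tensor_map_def)

lemma lin_map_plus:
  assumes "star_algebra B" "f \<in> lin_map A B" "g \<in> lin_map A B"
  shows "(\<lambda>x. f x \<oplus>\<^bsub>B\<^esub> g x) \<in> lin_map A B"
proof -
  interpret B: star_algebra B by fact
  show ?thesis
    by (rule lin_mapI)
      (simp_all add: lin_mapD[OF assms(2)] lin_mapD[OF assms(3)] B.smult_r_distr B.a_ac)
qed

lemma tensor_assoc:
  fixes A :: "('a, 'm) star_alg_scheme" and B :: "('b, 'n) star_alg_scheme" and C :: "('c, 'o) star_alg_scheme"
  assumes A: "star_algebra A" and B: "star_algebra B" and C: "star_algebra C"
  shows tensor_assoc_lin_map: "tensor_assoc A B C \<in>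
      lin_map (tensor_alg (tensor_alg A B) C) (tensor_alg A (tensor_alg B C))"
    and tensor_assoc_tensor: "a \<in> carrier A \<Longrightarrow> b \<in> carrier B \<Longrightarrow> c \<in> carrier C \<Longrightarrow>
      tensor_assoc A B C (tensor (tensor_alg A B) C (tensor A B a b) c) =
        tensor A (tensor_alg B C) a (tensor B C b c)"
proof -
  let ?BC = "tensor_alg B C" and ?AB = "tensor_alg A B"
  let ?T = "tensor_alg A ?BC"
  have BC: "star_algebra ?BC" and AB: "star_algebra ?AB" and T: "star_algebra ?T"
    by (simp_all add: tensor_alg_star_algebra A B C)
  let ?\<beta> = "\<lambda>c a b. tensor A ?BC a (tensor B C b c)"
  have tA: "(\<lambda>a. tensor A ?BC a y) \<in> lin_map A ?T" if "y \<in> carrier ?BC" for y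
    using that bilinear_tensor[OF A BC] by (auto simp: bilinear_def)
  have tBC: "tensor A ?BC a \<in> lin_map ?BC ?T" if "a \<in> carrier A" for a
    using that bilinear_tensor[OF A BC] by (auto simp: bilinear_def)
  have tB: "(\<lambda>b. tensor B C b c) \<in> lin_map B ?BC" if "c \<in> carrier C" for c
    using that bilinear_tensor[OF B C] by (auto simp: bilinear_def)
  have \<beta>: "bilinear A B ?T (?\<beta> c)" if c: "c \<in> carrier C" for c
    using bilinear_comp[OF bilinear_tensor[OF A BC] lin_map_id tB[OF c]] .
  note lift = tensor_lift_lin_map[OF A B T \<beta>] tensor_lift_tensor[OF A B T \<beta>]
  interpret C: star_algebra C by fact
  interpret T: star_algebra ?T by fact
  \<comment> \<open>The outer map is linear in \<open>X\<close> by construction; linearity in \<open>c\<close> is checked on pure tensors \<open>X\<close>.\<close>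
  let ?\<gamma> = "\<lambda>X c. tensor_lift ?T (?\<beta> c) X"
  have right: "?\<gamma> X \<in> lin_map C ?T" if X: "X \<in> carrier ?AB" for X
  proof (rule lin_mapI)
    fix c d assume cd: "c \<in> carrier C" "d \<in> carrier C"
    show "?\<gamma> X c \<in> carrier ?T" using lin_map_closed[OF lift(1) X] cd by simp
    show "?\<gamma> X (c \<oplus>\<^bsub>C\<^esub> d) = ?\<gamma> X c \<oplus>\<^bsub>?T\<^esub> ?\<gamma> X d"
      by (rule lin_map_eqI_tensor_alg[OF A B T _ _ _ X])
        (use cd in \<open>simp_all add: lift lin_map_plus[OF T] tensor_add_right[OF B C] tensor_closed[OF B C]
          lin_map_add[OF tBC]\<close>)
  next
    fix c k assume c: "c \<in> carrier C"
    show "?\<gamma> X (k \<odot>\<^bsub>C\<^esub> c) = k \<odot>\<^bsub>?T\<^esub> ?\<gamma> X c"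
      by (rule lin_map_eqI_tensor_alg[OF A B T _ lin_map_comp[OF lift(1) lin_map_smult_map[OF T]] _ X])
        (use c in \<open>simp_all add: lift C.smult_closed tensor_smult_right[OF B C] tensor_closed[OF B C]
          lin_map_smult[OF tBC]\<close>)
  qed
  have \<gamma>: "bilinear ?AB C ?T ?\<gamma>"
    unfolding bilinear_def by (auto simp: right lift)
  have assoc: "tensor_assoc A B C = tensor_lift ?T ?\<gamma>"
    by (simp add: tensor_assoc_def Let_def)
  show "tensor_assoc A B C \<in> lin_map (tensor_alg ?AB C) ?T"
    unfolding assoc by (rule tensor_lift_lin_map[OF AB C T \<gamma>])
  show "tensor_assoc A B C (tensor ?AB C (tensor A B a b) c) = tensor A ?BC a (tensor B C b c)"
    if "a \<in> carrier A" "b \<in> carrier B" "c \<in> carrier C"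
    using that unfolding assoc
    by (simp add: tensor_lift_tensor[OF AB C T \<gamma>] tensor_closed[OF A B] lift)
qed

section \<open>Bilinear maps used in the Hopf algebra axioms\<close>

text \<open>
  The axioms mention only the named fields.  This transfers them between record types, such as an algebra
  and its extension by Hopf algebra operations.
\<close>

lemma star_algebra_cong:
  assumes A: "star_algebra A"
    and eq: "carrier B = carrier A" "mult B = mult A" "one B = one A" "zero B = zero A"
      "add B = add A" "smult B = smult A" "star B = star A"
  shows "star_algebra B"
proof -
  interpret star_algebra A by fact
  show ?thesis
    by (intro star_algebra.intro star_algebra_axioms.intro ringI abelian_groupI monoidI; unfold eq)
      (auto simp: smult_closed star_closed a_ac m_assoc l_distr r_distr
        smult_l_distr smult_r_distr smult_assoc smult_one smult_mult_left smult_mult_right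
        star_add star_smult star_mult star_star intro!: bexI[of _ "\<ominus>\<^bsub>A\<^esub> x" for x] l_neg)
qed

lemma complex_alg_star_algebra: "star_algebra complex_alg"
  by (intro star_algebra.intro star_algebra_axioms.intro ringI abelian_groupI monoidI)
    (auto simp: complex_alg_def algebra_simps intro: exI[of _ "- x" for x])

lemma bilinear_swap: "bilinear A B C \<beta> \<Longrightarrow> bilinear B A C (\<lambda>b a. \<beta> a b)"
  by (simp add: bilinear_def)

lemma bilinear_mult:
  assumes "star_algebra A"
  shows "bilinear A A A (\<lambda>a b. a \<otimes>\<^bsub>A\<^esub> b)"
  using lin_map_mult_left[OF assms] lin_map_mult_right[OF assms] by (simp add: bilinear_def)

lemma bilinear_smult:
  assumes "star_algebra B" "f \<in> lin_map A complex_alg"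
  shows "bilinear A B B (\<lambda>a b. f a \<odot>\<^bsub>B\<^esub> b)"
proof -
  interpret star_algebra B by fact
  have "f (x \<oplus>\<^bsub>A\<^esub> y) = f x + f y" "f (c \<odot>\<^bsub>A\<^esub> x) = c * f x"
    if "x \<in> carrier A" "y \<in> carrier A" for x y c
    using that by (simp_all add: lin_mapD[OF assms(2)] complex_alg_def)
  then show ?thesis
    by (auto simp: bilinear_def smult_closed smult_l_distr smult_assoc
        intro!: lin_mapI lin_map_smult_map[OF assms(1)])
qed

section \<open>The Hopf algebra of Laurent polynomials\<close>

lemma laurent_alg_star_algebra: "star_algebra laurent_alg"
  unfolding laurent_alg_def
  by (rule monoid_alg_star_algebra) (auto simp: group.is_monoid)

lemma OU1_simps:
  "carrier OU1 = carrier laurent_alg" "mult OU1 = mult laurent_alg" "one OU1 = one laurent_alg"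
  "zero OU1 = zero laurent_alg" "add OU1 = add laurent_alg" "smult OU1 = smult laurent_alg"
  "star OU1 = star laurent_alg"
  "comult OU1 = lin_ext (tensor_alg laurent_alg laurent_alg)
     (\<lambda>n. tensor laurent_alg laurent_alg (upow n) (upow n))"
  "counit OU1 = lin_ext complex_alg (\<lambda>n. 1)"
  "antipode OU1 = lin_ext laurent_alg (\<lambda>n. upow (- n))"
  by (simp_all add: OU1_def star_alg.extend_def hopf_alg.fields_def)

lemma OU1_star_algebra: "star_algebra OU1"
  by (rule star_algebra_cong[OF laurent_alg_star_algebra]) (simp_all add: OU1_simps)

lemma upow_simps:
  "upow n \<in> carrier OU1"
  "upow m \<otimes>\<^bsub>OU1\<^esub> upow n = upow (m + n)"
  "\<one>\<^bsub>OU1\<^esub> = upow 0"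
  "star OU1 (upow n) = upow (- n)"
  by (simp_all add: OU1_simps laurent_alg_def upow_def monoid_alg_simps monoid_alg_linearity)

lemma lin_map_OU1: "lin_map OU1 B = lin_map laurent_alg B" "lin_map A OU1 = lin_map A laurent_alg"
  by (simp_all add: lin_map_def OU1_simps)

lemma alg_hom_OU1: "alg_hom OU1 B = alg_hom laurent_alg B"
  by (simp add: alg_hom_def ring_hom_def lin_map_OU1 OU1_simps)

text \<open>
  The comultiplication is defined with values in the tensor square of the underlying algebra, while the
  Hopf algebra axioms refer to the tensor square of the extended record; the two coincide.
\<close>

lemma tensor_OU1:
  "tensor_alg OU1 OU1 = tensor_alg laurent_alg laurent_alg"
  "tensor OU1 OU1 = tensor laurent_alg laurent_alg"
proof -
  have F: "formal_tensors OU1 OU1 = formal_tensors laurent_alg laurent_alg"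
    by (simp add: formal_tensors_def DirProd_def OU1_simps)
  have "bilinear_rels OU1 OU1 = bilinear_rels laurent_alg laurent_alg"
  proof (intro subset_antisym subsetI)
    show "x \<in> bilinear_rels laurent_alg laurent_alg" if "x \<in> bilinear_rels OU1 OU1" for x
      using that by cases (simp_all add: OU1_simps bilinear_rels.intros)
    show "x \<in> bilinear_rels OU1 OU1" if "x \<in> bilinear_rels laurent_alg laurent_alg" for x
      using that by cases (simp_all add: bilinear_rels.intros flip: OU1_simps)
  qed
  then have N: "tensor_null OU1 OU1 = tensor_null laurent_alg laurent_alg"
    by (simp add: tensor_null_def F)
  show "tensor_alg OU1 OU1 = tensor_alg laurent_alg laurent_alg"
    "tensor OU1 OU1 = tensor laurent_alg laurent_alg"
    by (simp_all add: tensor_alg_def tensor_def fun_eq_iff F N)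
qed

lemma lin_map_eqI_OU1:
  assumes "star_algebra B" "f \<in> lin_map OU1 B" "g \<in> lin_map OU1 B"
    and "\<And>n. f (upow n) = g (upow n)" and "h \<in> carrier OU1"
  shows "f h = g h"
  using lin_map_eqI_monoid_alg[of integer_group uminus B f g h] assms laurent_alg_star_algebra
  by (simp add: lin_map_OU1 OU1_simps laurent_alg_def upow_def)

lemma OU1_tensor_star_algebra: "star_algebra (tensor_alg OU1 OU1)"
  by (rule tensor_alg_star_algebra[OF OU1_star_algebra OU1_star_algebra])

lemma comult_OU1_upow: "comult OU1 (upow n) = tensor OU1 OU1 (upow n) (upow n)"
proof -
  interpret T: star_algebra "tensor_alg OU1 OU1" by (rule OU1_tensor_star_algebra)
  have "tensor OU1 OU1 (upow n) (upow n) \<in> carrier (tensor_alg OU1 OU1)"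
    by (simp add: tensor_closed OU1_star_algebra upow_simps)
  then show ?thesis
    using lin_ext_single[OF OU1_tensor_star_algebra, of "\<lambda>n. tensor OU1 OU1 (upow n) (upow n)" n 1]
    by (simp add: OU1_simps T.smult_one flip: tensor_OU1 upow_def)
qed

lemma counit_OU1_upow: "counit OU1 (upow n) = 1"
  using lin_ext_single[OF complex_alg_star_algebra, of "\<lambda>n. 1" n 1]
  by (simp add: OU1_simps complex_alg_def upow_def)

lemma antipode_OU1_upow: "antipode OU1 (upow n) = upow (- n)"
  using lin_ext_single[OF laurent_alg_star_algebra, of "\<lambda>n. upow (- n)" n 1]
    star_algebra.smult_one[OF laurent_alg_star_algebra] upow_simps(1)
  by (simp add: OU1_simps flip: upow_def)

lemma lin_ext_OU1_alg_hom:
  assumes B: "star_algebra B" and "\<And>n. \<phi> n \<in> carrier B"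
    and "\<And>m n. \<phi> (m + n) = \<phi> m \<otimes>\<^bsub>B\<^esub> \<phi> n" and "\<phi> 0 = \<one>\<^bsub>B\<^esub>"
  shows "lin_ext B \<phi> \<in> alg_hom OU1 B"
  unfolding alg_hom_OU1 laurent_alg_def
  by (rule lin_ext_alg_hom)
    (use assms laurent_alg_star_algebra in \<open>auto simp: laurent_alg_def group.is_monoid\<close>)

lemma comult_OU1_alg_hom: "comult OU1 \<in> alg_hom OU1 (tensor_alg OU1 OU1)"
  unfolding OU1_simps tensor_OU1[symmetric]
  by (rule lin_ext_OU1_alg_hom[OF OU1_tensor_star_algebra])
    (simp_all add: tensor_closed tensor_mult tensor_one OU1_star_algebra upow_simps)

lemma counit_OU1_alg_hom: "counit OU1 \<in> alg_hom OU1 complex_alg"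
  unfolding OU1_simps
  by (rule lin_ext_OU1_alg_hom[OF complex_alg_star_algebra]) (simp_all add: complex_alg_def)

lemma antipode_OU1_lin_map: "antipode OU1 \<in> lin_map OU1 OU1"
  unfolding OU1_simps lin_map_OU1 unfolding laurent_alg_def
  by (rule lin_ext_lin_map[OF laurent_alg_star_algebra[unfolded laurent_alg_def]])
    (simp add: upow_def single_in_monoid_alg)

text \<open>
  Coassociativity and the counit and antipode axioms are identities between linear maps, and the powers \<open>u\<^sup>n\<close> are a basis on which
  \<open>\<Delta>(u\<^sup>n) = u\<^sup>n \<otimes> u\<^sup>n\<close>, \<open>\<epsilon>(u\<^sup>n) = 1\<close> and \<open>S(u\<^sup>n) = u\<^sup>-\<^sup>n\<close>.  The antipode is
  bijective because it is an involution.
\<close>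

lemma OU1_hopf_algebra: "hopf_algebra OU1"
proof (intro hopf_algebra.intro hopf_algebra_axioms.intro OU1_star_algebra comult_OU1_alg_hom
    counit_OU1_alg_hom antipode_OU1_lin_map)
  interpret H: star_algebra OU1 by (rule OU1_star_algebra)
  let ?H = OU1 and ?HH = "tensor_alg OU1 OU1"
  note H = OU1_star_algebra and HH = OU1_tensor_star_algebra
  note \<Delta> = alg_hom_lin[OF comult_OU1_alg_hom] and \<epsilon> = alg_hom_lin[OF counit_OU1_alg_hom]
    and S = antipode_OU1_lin_map
  note id = lin_map_id[of ?H]
  \<comment> \<open>The counit and antipode axioms all have this shape.\<close>
  have lift: "tensor_lift ?H \<beta> (comult ?H h) = f h"
    if \<beta>: "bilinear ?H ?H ?H \<beta>" and f: "f \<in> lin_map ?H ?H" and h: "h \<in> carrier ?H"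
      and eq: "\<And>n. \<beta> (upow n) (upow n) = f (upow n)" for \<beta> f h
    by (rule lin_map_eqI_OU1[OF H lin_map_comp[OF \<Delta> tensor_lift_lin_map[OF H H H \<beta>]] f _ h])
      (simp add: comult_OU1_upow tensor_lift_tensor[OF H H H \<beta>] upow_simps eq)
  have unit: "(\<lambda>h. counit ?H h \<odot>\<^bsub>?H\<^esub> \<one>\<^bsub>?H\<^esub>) \<in> lin_map ?H ?H"
    using bilinear_smult[OF H \<epsilon>] by (simp add: bilinear_def)
  fix h assume h: "h \<in> carrier ?H"
  show "tensor_assoc ?H ?H ?H (tensor_map ?HH ?H (comult ?H) id (comult ?H h)) =
      tensor_map ?H ?HH id (comult ?H) (comult ?H h)"
    unfolding id_def
  proof (rule lin_map_eqI_OU1[OF tensor_alg_star_algebra[OF H HH] _ _ _ h])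
    show "(\<lambda>h. tensor_assoc ?H ?H ?H (tensor_map ?HH ?H (comult ?H) (\<lambda>x. x) (comult ?H h)))
        \<in> lin_map ?H (tensor_alg ?H ?HH)"
      by (intro lin_map_comp[OF lin_map_comp[OF \<Delta> tensor_map_lin_map[OF H H HH H \<Delta> id]]]
          tensor_assoc_lin_map H)
    show "(\<lambda>h. tensor_map ?H ?HH (\<lambda>x. x) (comult ?H) (comult ?H h)) \<in> lin_map ?H (tensor_alg ?H ?HH)"
      by (rule lin_map_comp[OF \<Delta> tensor_map_lin_map[OF H H H HH id \<Delta>]])
  qed (simp add: comult_OU1_upow upow_simps tensor_map_tensor[OF H H HH H \<Delta> id]
      tensor_map_tensor[OF H H H HH id \<Delta>] tensor_assoc_tensor[OF H H H])
  show "tensor_lift ?H (\<lambda>a b. counit ?H a \<odot>\<^bsub>?H\<^esub> b) (comult ?H h) = h"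
    by (rule lift[OF bilinear_smult[OF H \<epsilon>] lin_map_id h])
      (simp add: counit_OU1_upow H.smult_one upow_simps)
  show "tensor_lift ?H (\<lambda>a b. counit ?H b \<odot>\<^bsub>?H\<^esub> a) (comult ?H h) = h"
    by (rule lift[OF bilinear_swap[OF bilinear_smult[OF H \<epsilon>]] lin_map_id h])
      (simp add: counit_OU1_upow H.smult_one upow_simps)
  show "tensor_lift ?H (\<lambda>a b. antipode ?H a \<otimes>\<^bsub>?H\<^esub> b) (comult ?H h) = counit ?H h \<odot>\<^bsub>?H\<^esub> \<one>\<^bsub>?H\<^esub>"
    by (rule lift[OF bilinear_comp[OF bilinear_mult[OF H] S lin_map_id] unit h])
      (simp add: antipode_OU1_upow counit_OU1_upow H.smult_one upow_simps)
  show "tensor_lift ?H (\<lambda>a b. a \<otimes>\<^bsub>?H\<^esub> antipode ?H b) (comult ?H h) = counit ?H h \<odot>\<^bsub>?H\<^esub> \<one>\<^bsub>?H\<^esub>"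
    by (rule lift[OF bilinear_comp[OF bilinear_mult[OF H] lin_map_id S] unit h])
      (simp add: antipode_OU1_upow counit_OU1_upow H.smult_one upow_simps)
next
  have "antipode OU1 (antipode OU1 h) = h" if "h \<in> carrier OU1" for h
    by (rule lin_map_eqI_OU1[OF OU1_star_algebra lin_map_comp[OF antipode_OU1_lin_map antipode_OU1_lin_map]
          lin_map_id _ that])
      (simp add: antipode_OU1_upow)
  then show "bij_betw (antipode OU1) (carrier OU1) (carrier OU1)"
    using lin_map_closed[OF antipode_OU1_lin_map]
    by (intro bij_betwI[where g = "antipode OU1"]) auto
qed

section \<open>Presented *-algebras\<close>

lemma free_star_alg_star_algebra: "star_algebra free_star_alg"
  unfolding free_star_alg_def
proof (rule monoid_alg_star_algebra)
  have "swap_letter (swap_letter a) = a" for a :: "'g letter" by (cases a) auto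
  then have "map (swap_letter \<circ> swap_letter) w = w" for w :: "'g letter list"
    by (intro map_idI) simp
  then show "rev (map swap_letter (rev (map swap_letter w))) = w" for w :: "'g letter list"
    by (simp add: rev_map)
qed (auto intro: monoidI)

lemma carrier_free_star_alg: "carrier free_star_alg = UNIV"
  by (auto simp: free_star_alg_def monoid_alg_simps)

text \<open>
  The elements whose adjoint lies in the generated ideal form an ideal, because the involution reverses
  products; it contains the generators, since these are closed under the involution.
\<close>

lemma (in star_algebra) genideal_star_ideal:
  assumes D: "D \<subseteq> carrier A"
  shows "star_ideal A (Idl (D \<union> star A ` D))"
proof -
  let ?S = "D \<union> star A ` D"
  have S: "?S \<subseteq> carrier A" using D star_closed by auto
  interpret I: ideal "Idl ?S" A by (rule genideal_ideal[OF S])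
  let ?J = "{x \<in> carrier A. star A x \<in> Idl ?S}"
  have "ideal ?J A"
  proof (intro idealI ring_axioms subgroup.intro)
    show "inv\<^bsub>add_monoid A\<^esub> x \<in> ?J" if "x \<in> ?J" for x
      using that ideal_smult_closed[OF I.ideal_axioms, of "star A x" "- 1"]
      by (simp add: a_inv_smult smult_closed star_smult flip: a_inv_def)
  qed (auto simp: star_add star_zero star_mult star_closed I.I_l_closed I.I_r_closed)
  moreover have "?S \<subseteq> ?J"
    using S genideal_self[OF S] by (auto simp: star_star star_closed)
  ultimately have "Idl ?S \<subseteq> ?J" by (rule genideal_minimal)
  then show ?thesis
    by (intro star_ideal.intro star_ideal_axioms.intro star_algebra_axioms I.ideal_axioms) auto
qed

lemma rel_ideal_star_ideal: "star_ideal free_star_alg (rel_ideal R)"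
  unfolding rel_ideal_def Let_def
  by (rule star_algebra.genideal_star_ideal[OF free_star_alg_star_algebra])
    (simp add: carrier_free_star_alg)

lemma presented_alg_star_algebra: "star_algebra (presented_alg R)"
  unfolding presented_alg_def
  by (rule star_ideal.quot_alg_star_algebra[OF rel_ideal_star_ideal])

abbreviation presented_class ::
    "(('g letter list \<Rightarrow>\<^sub>0 complex) \<times> ('g letter list \<Rightarrow>\<^sub>0 complex)) set \<Rightarrow>
     ('g letter list \<Rightarrow>\<^sub>0 complex) \<Rightarrow> ('g letter list \<Rightarrow>\<^sub>0 complex) set" where
  "presented_class R x \<equiv> rel_ideal R +>\<^bsub>free_star_alg\<^esub> x"

lemma presented_class_alg_hom: "presented_class R \<in> alg_hom free_star_alg (presented_alg R)"
  unfolding presented_alg_def by (rule star_ideal.coset_alg_hom[OF rel_ideal_star_ideal])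

lemma presented_class_star: "presented_class R (star free_star_alg x) = star (presented_alg R) (presented_class R x)"
  unfolding presented_alg_def
  by (simp add: star_ideal.star_coset[OF rel_ideal_star_ideal] carrier_free_star_alg)

lemma carrier_presented_alg: "carrier (presented_alg R) = range (presented_class R)"
  by (simp add: presented_alg_def star_ideal.carrier_quot_alg[OF rel_ideal_star_ideal] carrier_free_star_alg)

lemma minus_free_star_alg: "x \<ominus>\<^bsub>free_star_alg\<^esub> y = x - y"
  using minus_monoid_alg[of "\<lparr>carrier = UNIV, mult = (@), one = []\<rparr>" "\<lambda>w. rev (map swap_letter w)" x y]
    free_star_alg_star_algebra
  by (simp add: free_star_alg_def monoid_alg_simps)

lemma presented_class_rel:
  assumes "(s, t) \<in> R"
  shows "presented_class R s = presented_class R t"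
proof -
  interpret star_algebra free_star_alg by (rule free_star_alg_star_algebra)
  have "s - t \<in> rel_ideal R"
    unfolding rel_ideal_def Let_def
    by (rule subsetD[OF genideal_self]) (use assms in \<open>force simp: carrier_free_star_alg\<close>)+
  then show ?thesis
    by (simp add: star_ideal.coset_eq_iff[OF rel_ideal_star_ideal] carrier_free_star_alg minus_free_star_alg)
qed

context
  fixes B :: "('b, 'm) star_alg_scheme" and \<phi> :: "'g \<Rightarrow> 'b"
  assumes B: "star_algebra B" and \<phi>: "\<And>g. \<phi> g \<in> carrier B"
begin

interpretation B: star_algebra B by (rule B)

lemma letter_val_closed: "letter_val B \<phi> a \<in> carrier B"
  by (cases a) (simp_all add: \<phi> B.star_closed)

lemma word_val_closed: "word_val B \<phi> w \<in> carrier B"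
  by (induction w) (simp_all add: word_val_def letter_val_closed)

lemma word_val_append: "word_val B \<phi> (v @ w) = word_val B \<phi> v \<otimes>\<^bsub>B\<^esub> word_val B \<phi> w"
  by (induction v)
    (simp_all add: word_val_closed[unfolded word_val_def] letter_val_closed B.m_assoc word_val_def)

lemma word_val_star: "word_val B \<phi> (rev (map swap_letter w)) = star B (word_val B \<phi> w)"
proof (induction w)
  case Nil
  then show ?case by (simp add: word_val_def B.star_one)
next
  case (Cons a w)
  have "letter_val B \<phi> (swap_letter a) = star B (letter_val B \<phi> a)"
    by (cases a) (simp_all add: \<phi> B.star_star)
  then have "word_val B \<phi> [swap_letter a] = star B (letter_val B \<phi> a)"
    by (simp add: word_val_def letter_val_closed B.star_closed)
  moreover have "word_val B \<phi> (a # w) = letter_val B \<phi> a \<otimes>\<^bsub>B\<^esub> word_val B \<phi> w"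
    by (simp add: word_val_def)
  ultimately show ?case
    by (simp add: word_val_append Cons B.star_mult letter_val_closed word_val_closed)
qed

lemma word_val_lin_ext_alg_hom: "lin_ext B (word_val B \<phi>) \<in> alg_hom free_star_alg B"
  unfolding free_star_alg_def
proof (rule lin_ext_alg_hom)
  show "word_val B \<phi> \<one>\<^bsub>\<lparr>carrier = UNIV, mult = (@), one = []\<rparr>\<^esub> = \<one>\<^bsub>B\<^esub>"
    by (simp add: word_val_def)
qed (use free_star_alg_star_algebra B in
    \<open>auto simp: free_star_alg_def word_val_closed word_val_append intro: monoidI\<close>)

lemma word_val_lin_ext_star:
  "lin_ext B (word_val B \<phi>) (star free_star_alg x) = star B (lin_ext B (word_val B \<phi>) x)"
  unfolding free_star_alg_def
  by (rule lin_ext_star)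
    (use free_star_alg_star_algebra B in
      \<open>auto simp: free_star_alg_def word_val_closed word_val_star monoid_alg_simps\<close>)

context
  fixes R :: "(('g letter list \<Rightarrow>\<^sub>0 complex) \<times> ('g letter list \<Rightarrow>\<^sub>0 complex)) set"
  assumes R: "\<And>s t. (s, t) \<in> R \<Longrightarrow> lin_ext B (word_val B \<phi>) s = lin_ext B (word_val B \<phi>) t"
begin

text \<open>
  The kernel is an ideal.  It contains the differences \<open>s - t\<close> by assumption and their adjoints because
  evaluation is a *-homomorphism, hence it contains the ideal that they generate.
\<close>

lemma word_val_lin_ext_rel_ideal:
  assumes "x \<in> rel_ideal R"
  shows "lin_ext B (word_val B \<phi>) x = \<zero>\<^bsub>B\<^esub>"
proof -
  let ?ev = "lin_ext B (word_val B \<phi>)"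
  interpret F: star_algebra free_star_alg by (rule free_star_alg_star_algebra)
  interpret ring_hom_ring free_star_alg B ?ev
    using word_val_lin_ext_alg_hom
    by (intro ring_hom_ringI2 F.ring_axioms B.ring_axioms) (simp add: alg_hom_def)
  have zero: "?ev (s - t) = \<zero>\<^bsub>B\<^esub>" if "(s, t) \<in> R" for s t
    using lin_map_minus[OF free_star_alg_star_algebra B alg_hom_lin[OF word_val_lin_ext_alg_hom], of s t]
      R[OF that] hom_closed[of t]
    by (simp add: carrier_free_star_alg minus_free_star_alg B.r_neg B.minus_eq)
  have "rel_ideal R \<subseteq> a_kernel free_star_alg B ?ev"
    unfolding rel_ideal_def Let_def
  proof (rule F.genideal_minimal[OF kernel_is_ideal], rule subsetI)
    fix d assume "d \<in> (\<lambda>(s, t). s - t) ` R \<union> star free_star_alg ` (\<lambda>(s, t). s - t) ` R"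
    then obtain s t where st: "(s, t) \<in> R" and d: "d = s - t \<or> d = star free_star_alg (s - t)"
      by (auto simp: image_iff)
    from d have "?ev d = \<zero>\<^bsub>B\<^esub>"
      by (rule disjE) (simp_all only: word_val_lin_ext_star zero[OF st] B.star_zero)
    then show "d \<in> a_kernel free_star_alg B ?ev"
      unfolding a_kernel_def' by (simp add: carrier_free_star_alg)
  qed
  with assms show ?thesis using kernel_zero by blast
qed

lemma presented_lift_alg_hom: "presented_lift B \<phi> \<in> alg_hom (presented_alg R) B"
  unfolding presented_alg_def presented_lift_def
  by (rule star_ideal.alg_hom_quot_alg[OF rel_ideal_star_ideal B word_val_lin_ext_alg_hom
        word_val_lin_ext_rel_ideal])

lemma presented_lift_class: "presented_lift B \<phi> (presented_class R x) = lin_ext B (word_val B \<phi>) x"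
  unfolding presented_lift_def
  by (rule star_ideal.the_elem_coset[OF rel_ideal_star_ideal B alg_hom_lin[OF word_val_lin_ext_alg_hom]
        word_val_lin_ext_rel_ideal]) (simp_all add: carrier_free_star_alg)

end

end

section \<open>Gradings and coactions of the circle\<close>

primrec letter_degree :: "('g \<Rightarrow> int) \<Rightarrow> 'g letter \<Rightarrow> int" where
  "letter_degree deg (Gen g) = deg g"
| "letter_degree deg (Adj g) = - deg g"

definition word_degree :: "('g \<Rightarrow> int) \<Rightarrow> 'g letter list \<Rightarrow> int" where
  "word_degree deg w = (\<Sum>a\<leftarrow>w. letter_degree deg a)"

definition homogeneous :: "('g \<Rightarrow> int) \<Rightarrow> int \<Rightarrow> ('g letter list \<Rightarrow>\<^sub>0 complex) \<Rightarrow> bool" where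
  "homogeneous deg d x \<longleftrightarrow> (\<forall>w\<in>Poly_Mapping.keys x. word_degree deg w = d)"

lemma homogeneous_single: "word_degree deg w = d \<Longrightarrow> homogeneous deg d (Poly_Mapping.single w c)"
  by (simp add: homogeneous_def)

lemma homogeneous_gen: "homogeneous deg (deg g) (free_gen g)"
  by (simp add: free_gen_def homogeneous_single word_degree_def)

lemma homogeneous_one: "homogeneous deg 0 \<one>\<^bsub>free_star_alg\<^esub>"
  by (simp add: free_star_alg_def monoid_alg_simps homogeneous_single word_degree_def)

lemma homogeneous_diff: "homogeneous deg d x \<Longrightarrow> homogeneous deg d y \<Longrightarrow> homogeneous deg d (x - y)"
  using keys_diff[of x y] by (auto simp: homogeneous_def)

lemma homogeneous_smult: "homogeneous deg d x \<Longrightarrow> homogeneous deg d (c \<odot>\<^bsub>free_star_alg\<^esub> x)"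
  using keys_smult_monoid_alg[of _ _ c x] by (fastforce simp: homogeneous_def free_star_alg_def)

lemma homogeneous_mult:
  assumes "homogeneous deg d x" "homogeneous deg e y"
  shows "homogeneous deg (d + e) (x \<otimes>\<^bsub>free_star_alg\<^esub> y)"
proof -
  have "Poly_Mapping.keys (x \<otimes>\<^bsub>free_star_alg\<^esub> y) \<subseteq>
      (\<Union>v\<in>Poly_Mapping.keys x. \<Union>w\<in>Poly_Mapping.keys y. {v @ w})"
    unfolding free_star_alg_def monoid_alg_def
    by (simp, intro order_trans[OF keys_sum] UN_mono order_refl) auto
  with assms show ?thesis by (fastforce simp: homogeneous_def word_degree_def)
qed

lemma homogeneous_star:
  assumes "homogeneous deg d x"
  shows "homogeneous deg (- d) (star free_star_alg x)"
proof -
  have "Poly_Mapping.keys (star free_star_alg x) \<subseteq>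
      (\<Union>w\<in>Poly_Mapping.keys x. {rev (map swap_letter w)})"
    unfolding free_star_alg_def monoid_alg_def
    by (simp, intro order_trans[OF keys_sum] UN_mono order_refl) auto
  moreover have "letter_degree deg (swap_letter a) = - letter_degree deg a" for a
    by (cases a) simp_all
  then have "word_degree deg (rev (map swap_letter w)) = - word_degree deg w" for w
    by (induction w) (simp_all add: word_degree_def)
  ultimately show ?thesis using assms by (fastforce simp: homogeneous_def)
qed

lemma homogeneous_list_prod:
  "(\<And>x. x \<in> set xs \<Longrightarrow> homogeneous deg 0 x) \<Longrightarrow> homogeneous deg 0 (list_prod free_star_alg xs)"
proof (induction xs)
  case Nil
  then show ?case by (simp add: list_prod_def homogeneous_one)
next
  case (Cons x xs)
  then show ?case
    using homogeneous_mult[of deg 0 x 0 "list_prod free_star_alg xs"] by (simp add: list_prod_def)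
qed

text \<open>
  A degree function for which every relation equates elements of the same degree.  Such a grading by the
  integers amounts to a coaction of the Laurent polynomials, \<open>a \<mapsto> a \<otimes> u\<^sup>d\<close> for \<open>a\<close> of degree \<open>d\<close>.
\<close>

locale graded_presentation =
  fixes R :: "(('g letter list \<Rightarrow>\<^sub>0 complex) \<times> ('g letter list \<Rightarrow>\<^sub>0 complex)) set"
    and deg :: "'g \<Rightarrow> int"
  assumes homogeneous_rels: "\<And>s t. (s, t) \<in> R \<Longrightarrow> \<exists>d. homogeneous deg d s \<and> homogeneous deg d t"
begin

abbreviation (input) "P \<equiv> presented_alg R"
abbreviation (input) "T \<equiv> tensor_alg P OU1"
abbreviation (input) "gen_coaction \<equiv> (\<lambda>g. tensor P OU1 (presented_gen R g) (upow (deg g)))"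
abbreviation (input) "graded_coaction \<equiv> presented_lift T gen_coaction"

lemma P_star_algebra: "star_algebra P" by (rule presented_alg_star_algebra)
lemma T_star_algebra: "star_algebra T" by (rule tensor_alg_star_algebra[OF P_star_algebra OU1_star_algebra])

interpretation P: star_algebra P by (rule P_star_algebra)
interpretation T: star_algebra T by (rule T_star_algebra)

lemma class_closed: "presented_class R x \<in> carrier P"
  by (simp add: carrier_presented_alg)

lemma gen_coaction_closed: "gen_coaction g \<in> carrier T"
  using class_closed by (simp add: presented_gen_def tensor_closed P_star_algebra OU1_star_algebra upow_simps)

text \<open>
  Both the product and the involution of the tensor product act factorwise, so the first factors assemble to
  the class of the word and the exponents of \<open>u\<close> add up to its degree.
\<close>

lemma word_val_coaction:
  "word_val T gen_coaction w =
    tensor P OU1 (presented_class R (Poly_Mapping.single w 1)) (upow (word_degree deg w))"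
proof (induction w)
  case Nil
  have "presented_class R (Poly_Mapping.single [] 1) = \<one>\<^bsub>P\<^esub>"
    using alg_hom_one[OF presented_class_alg_hom, of R]
    by (simp add: free_star_alg_def monoid_alg_simps)
  then show ?case
    by (simp add: word_val_def word_degree_def tensor_one[OF P_star_algebra OU1_star_algebra] upow_simps)
next
  case (Cons a w)
  have "letter_val T gen_coaction a =
      tensor P OU1 (presented_class R (Poly_Mapping.single [a] 1)) (upow (letter_degree deg a))"
  proof (cases a)
    case (Gen g)
    then show ?thesis by (simp add: presented_gen_def free_gen_def)
  next
    case (Adj g)
    have "star free_star_alg (free_gen g) = Poly_Mapping.single [Adj g] 1"
      by (simp add: free_star_alg_def free_gen_def star_single_monoid_alg)
    then have "star P (presented_gen R g) = presented_class R (Poly_Mapping.single [Adj g] 1)"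
      using presented_class_star[of R "free_gen g"] by (simp add: presented_gen_def)
    with Adj show ?thesis
      by (simp add: tensor_star[OF P_star_algebra OU1_star_algebra] class_closed presented_gen_def upow_simps)
  qed
  moreover have "Poly_Mapping.single (a # w) 1 =
      Poly_Mapping.single [a] 1 \<otimes>\<^bsub>free_star_alg\<^esub> Poly_Mapping.single w (1::complex)"
    by (simp add: free_star_alg_def mult_single_monoid_alg)
  ultimately show ?case
    using Cons alg_hom_mult[OF presented_class_alg_hom, of "Poly_Mapping.single [a] 1" "Poly_Mapping.single w 1" R]
    by (simp add: word_val_def word_degree_def tensor_mult[OF P_star_algebra OU1_star_algebra] class_closed upow_simps
        carrier_free_star_alg)
qed

text \<open>
  For fixed \<open>d\<close> both sides are linear, and a homogeneous element of degree \<open>d\<close> is a combination of words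
  of degree \<open>d\<close>.
\<close>

lemma word_val_coaction_homogeneous:
  assumes "homogeneous deg d x"
  shows "lin_ext T (word_val T gen_coaction) x = tensor P OU1 (presented_class R x) (upow d)"
proof -
  let ?ev = "lin_ext T (word_val T gen_coaction)"
  let ?t = "\<lambda>x. tensor P OU1 (presented_class R x) (upow d)"
  have ev: "?ev \<in> lin_map free_star_alg T"
    by (rule alg_hom_lin[OF word_val_lin_ext_alg_hom[OF T_star_algebra gen_coaction_closed]])
  have "(\<lambda>a. tensor P OU1 a (upow d)) \<in> lin_map P T"
    using bilinear_tensor[OF P_star_algebra OU1_star_algebra] by (simp add: bilinear_def upow_simps)
  then have t: "?t \<in> lin_map free_star_alg T"
    by (rule lin_map_comp[OF alg_hom_lin[OF presented_class_alg_hom]])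
  have supp: "Poly_Mapping.keys x \<subseteq> {w. word_degree deg w = d}"
    using assms by (auto simp: homogeneous_def)
  have zero: "(0 :: 'g letter list \<Rightarrow>\<^sub>0 complex) = \<zero>\<^bsub>free_star_alg\<^esub>"
    and add: "x + y = x \<oplus>\<^bsub>free_star_alg\<^esub> y" for x y :: "'g letter list \<Rightarrow>\<^sub>0 complex"
    by (simp_all add: free_star_alg_def monoid_alg_simps)
  have word_closed: "word_val T gen_coaction w \<in> carrier T" for w
    by (rule word_val_closed[OF T_star_algebra gen_coaction_closed])
  show ?thesis
    using supp
  proof (induction rule: supported_induct)
    case zero
    show ?case
      unfolding \<open>0 = \<zero>\<^bsub>free_star_alg\<^esub>\<close>
      using lin_map_zero[OF free_star_alg_star_algebra T_star_algebra ev]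
        lin_map_zero[OF free_star_alg_star_algebra T_star_algebra t]
      by simp
  next
    case (add x y)
    then show ?case
      using lin_map_add[OF ev, of x y] lin_map_add[OF t, of x y]
      by (simp add: carrier_free_star_alg \<open>\<And>x y. x + y = x \<oplus>\<^bsub>free_star_alg\<^esub> y\<close>)
  next
    case (single w c)
    have "Poly_Mapping.single w c = c \<odot>\<^bsub>free_star_alg\<^esub> Poly_Mapping.single w 1"
      by (simp add: free_star_alg_def smult_single_monoid_alg)
    moreover have "?ev (Poly_Mapping.single w 1) = ?t (Poly_Mapping.single w 1)"
      using single lin_ext_single[where \<phi> = "word_val T gen_coaction" and k = w and a = 1, OF T_star_algebra word_closed]
      by (simp add: word_val_coaction T.smult_one tensor_closed[OF P_star_algebra OU1_star_algebra] class_closed upow_simps)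
    ultimately show ?case
      by (simp add: lin_map_smult[OF ev] lin_map_smult[OF t] carrier_free_star_alg)
  qed
qed

text \<open>
  A relation becomes an equality of classes, and homogeneity provides the same power of \<open>u\<close> on both
  sides.
\<close>

lemma word_val_coaction_rel:
  assumes "(s, t) \<in> R"
  shows "lin_ext T (word_val T gen_coaction) s = lin_ext T (word_val T gen_coaction) t"
proof -
  obtain d where "homogeneous deg d s" "homogeneous deg d t" using homogeneous_rels[OF assms] by blast
  then show ?thesis
    by (simp only: word_val_coaction_homogeneous presented_class_rel[OF assms])
qed

lemma graded_coaction_alg_hom: "graded_coaction \<in> alg_hom P T"
  by (rule presented_lift_alg_hom[OF T_star_algebra gen_coaction_closed word_val_coaction_rel])

lemma graded_coaction_homogeneous:
  assumes "homogeneous deg d x"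
  shows "graded_coaction (presented_class R x) = tensor P OU1 (presented_class R x) (upow d)"
  using word_val_coaction_homogeneous[OF assms]
    presented_lift_class[OF T_star_algebra gen_coaction_closed word_val_coaction_rel] by simp

text \<open>
  Words are homogeneous, so the classes of homogeneous elements span the presented algebra.
\<close>

lemma lin_map_eqI_presented_alg:
  assumes C: "star_algebra C" and f: "f \<in> lin_map P C" and g: "g \<in> lin_map P C"
    and eq: "\<And>x d. homogeneous deg d x \<Longrightarrow> f (presented_class R x) = g (presented_class R x)"
    and a: "a \<in> carrier P"
  shows "f a = g a"
proof -
  obtain x where x: "a = presented_class R x" using a by (auto simp: carrier_presented_alg)
  note cls = alg_hom_lin[OF presented_class_alg_hom[of R], unfolded free_star_alg_def]
  show ?thesis
    unfolding x
    by (rule lin_map_eqI_monoid_alg[OF _ C lin_map_comp[OF cls f] lin_map_comp[OF cls g],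
          folded free_star_alg_def, OF free_star_alg_star_algebra])
      (auto intro: eq homogeneous_single simp: carrier_free_star_alg)
qed

text \<open>
  On a class \<open>a\<close> of degree \<open>d\<close>, both sides of coassociativity equal \<open>a \<otimes> (u\<^sup>d \<otimes> u\<^sup>d)\<close>, and the counit
  returns \<open>a\<close> since \<open>\<epsilon>(u\<^sup>d) = 1\<close>.
\<close>

theorem graded_comodule_algebra: "right_comodule_algebra P OU1 graded_coaction"
proof (intro right_comodule_algebra.intro right_comodule_algebra_axioms.intro OU1_hopf_algebra P_star_algebra
    graded_coaction_alg_hom)
  let ?H = OU1 and ?HH = "tensor_alg OU1 OU1"
  note H = OU1_star_algebra and HH = OU1_tensor_star_algebra
  note \<Delta> = alg_hom_lin[OF comult_OU1_alg_hom] and \<epsilon> = alg_hom_lin[OF counit_OU1_alg_hom]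
    and \<rho> = alg_hom_lin[OF graded_coaction_alg_hom]
  note id = lin_map_id
  fix a assume a: "a \<in> carrier P"
  show "tensor_assoc P ?H ?H (tensor_map T ?H graded_coaction id (graded_coaction a)) =
      tensor_map P ?HH id (comult ?H) (graded_coaction a)"
    unfolding id_def
  proof (rule lin_map_eqI_presented_alg[OF tensor_alg_star_algebra[OF P_star_algebra HH] _ _ _ a])
    show "(\<lambda>a. tensor_assoc P ?H ?H (tensor_map T ?H graded_coaction (\<lambda>x. x) (graded_coaction a)))
        \<in> lin_map P (tensor_alg P ?HH)"
      by (intro lin_map_comp[OF lin_map_comp[OF \<rho> tensor_map_lin_map[OF P_star_algebra H T_star_algebra H \<rho> id]]]
          tensor_assoc_lin_map P_star_algebra H)
    show "(\<lambda>a. tensor_map P ?HH (\<lambda>x. x) (comult ?H) (graded_coaction a)) \<in> lin_map P (tensor_alg P ?HH)"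
      by (rule lin_map_comp[OF \<rho> tensor_map_lin_map[OF P_star_algebra H P_star_algebra HH id \<Delta>]])
  qed (simp add: graded_coaction_homogeneous comult_OU1_upow upow_simps class_closed
      tensor_map_tensor[OF P_star_algebra H T_star_algebra H \<rho> id]
      tensor_map_tensor[OF P_star_algebra H P_star_algebra HH id \<Delta>]
      tensor_assoc_tensor[OF P_star_algebra H H])
  note \<beta> = bilinear_swap[OF bilinear_smult[OF P_star_algebra \<epsilon>]]
  show "tensor_lift P (\<lambda>b h. counit ?H h \<odot>\<^bsub>P\<^esub> b) (graded_coaction a) = a"
    by (rule lin_map_eqI_presented_alg[OF P_star_algebra
          lin_map_comp[OF \<rho> tensor_lift_lin_map[OF P_star_algebra H P_star_algebra \<beta>]] lin_map_id _ a])
      (simp add: graded_coaction_homogeneous tensor_lift_tensor[OF P_star_algebra H P_star_algebra \<beta>] upow_simps class_closed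
        counit_OU1_upow P.smult_one)
qed

end

section \<open>Invertible elements of degree one\<close>

text \<open>
  Colinear algebra maps from the Laurent polynomials correspond to invertible elements \<open>v\<close> of degree
  one, through \<open>j(u\<^sup>n) = v\<^sup>n\<close>.  The powers of \<open>v\<close> are taken in the group of units, which supplies the
  negative exponents.
\<close>

lemma trivial_comodule_algebraI:
  fixes A :: "('a, 'm) star_alg_scheme"
  assumes comod: "right_comodule_algebra A OU1 \<rho>"
    and v: "v \<in> carrier A" and w: "w \<in> carrier A"
    and inv: "v \<otimes>\<^bsub>A\<^esub> w = \<one>\<^bsub>A\<^esub>" "w \<otimes>\<^bsub>A\<^esub> v = \<one>\<^bsub>A\<^esub>"
    and \<rho>v: "\<rho> v = tensor A OU1 v (upow 1)" and \<rho>w: "\<rho> w = tensor A OU1 w (upow (- 1))"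
  shows "trivial_comodule_algebra A OU1 \<rho>"
proof -
  have A: "star_algebra A" using comod by (simp add: right_comodule_algebra_def)
  interpret A: star_algebra A by (rule A)
  note H = OU1_star_algebra
  let ?T = "tensor_alg A OU1"
  have T: "star_algebra ?T" by (rule tensor_alg_star_algebra[OF A H])
  have \<rho>: "\<rho> \<in> alg_hom A ?T"
    using comod by (simp add: right_comodule_algebra_def right_comodule_algebra_axioms_def)
  interpret U: group "units_of A" by (rule A.units_group)
  define p where "p n = v [^]\<^bsub>units_of A\<^esub> n" for n :: int
  have vU: "v \<in> carrier (units_of A)" and wU: "w \<in> carrier (units_of A)"
    using v w inv by (auto simp: units_of_carrier Units_def)
  have p_closed: "p n \<in> carrier A" for n
    using U.int_pow_closed[OF vU, of n] by (auto simp: p_def units_of_carrier Units_def)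
  have p_add: "p (m + n) = p m \<otimes>\<^bsub>A\<^esub> p n" for m n
    using U.int_pow_mult[OF vU] by (simp add: p_def units_of_mult)
  have p_0: "p 0 = \<one>\<^bsub>A\<^esub>" by (simp add: p_def units_of_one)
  have p_1: "p 1 = v" using U.int_pow_1[OF vU] by (simp add: p_def)
  have "inv\<^bsub>units_of A\<^esub> v = w"
    using inv vU wU by (intro U.inv_equality) (simp_all add: units_of_mult units_of_one)
  then have p_m1: "p (- 1) = w" using U.int_pow_neg[OF vU, of 1] U.int_pow_1[OF vU] by (simp add: p_def)
  \<comment> \<open>Multiplicativity of \<open>\<rho>\<close> propagates the degree from \<open>v\<close> and its inverse to all powers.\<close>
  have \<rho>p: "\<rho> (p n) = tensor A OU1 (p n) (upow n)" for n
  proof (induction n rule: int_induct[where k = 0])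
    case base
    show ?case
      by (simp add: p_0 alg_hom_one[OF \<rho>] tensor_one[OF A H] upow_simps)
  next
    case (step1 n)
    then show ?case
      by (simp add: p_add p_1 alg_hom_mult[OF \<rho>] p_closed v \<rho>v tensor_mult[OF A H] upow_simps)
  next
    case (step2 n)
    then show ?case
      using p_add[of n "- 1"]
      by (simp add: p_m1 alg_hom_mult[OF \<rho>] p_closed w \<rho>w tensor_mult[OF A H] upow_simps)
  qed
  define j where "j = lin_ext A p"
  have j: "j \<in> alg_hom OU1 A"
    unfolding j_def by (rule lin_ext_OU1_alg_hom[OF A]) (simp_all add: p_closed p_add p_0)
  have j_upow: "j (upow n) = p n" for n
    using lin_ext_single[where \<phi> = p and k = n and a = 1, OF A p_closed] by (simp add: j_def upow_def A.smult_one p_closed)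
  note id = lin_map_id[of OU1]
  have "\<rho> (j h) = tensor_map A OU1 j id (comult OU1 h)" if h: "h \<in> carrier OU1" for h
    unfolding id_def
    by (rule lin_map_eqI_OU1[OF T lin_map_comp[OF alg_hom_lin[OF j] alg_hom_lin[OF \<rho>]]
          lin_map_comp[OF alg_hom_lin[OF comult_OU1_alg_hom] tensor_map_lin_map[OF H H A H alg_hom_lin[OF j] id]]
          _ h])
      (simp add: j_upow \<rho>p comult_OU1_upow tensor_map_tensor[OF H H A H alg_hom_lin[OF j] id] upow_simps)
  with comod j show ?thesis by (auto simp: trivial_comodule_algebra_def)
qed

section \<open>The algebra of the quantum space\<close>

text \<open>
  The product \<open>y'z'\<close> has degree \<open>0\<close>, hence so do the two products that express \<open>x'x'\<^sup>*\<close> and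
  \<open>x'\<^sup>*x'\<close>; in \<open>y'\<^sup>* = y'z'\<^sup>2\<close> both sides have degree \<open>-1\<close>, and the other relations only
  reorder factors, up to a scalar, or state that \<open>z'\<close> is unitary.
\<close>

lemma sigma_rels_homogeneous:
  assumes "(s, t) \<in> sigma_rels q l"
  shows "\<exists>d. homogeneous sigma_degree d s \<and> homogeneous sigma_degree d t"
proof -
  let ?h = "homogeneous sigma_degree"
  let ?F = "free_star_alg :: (sigma_gen letter list \<Rightarrow>\<^sub>0 complex) star_alg"
  have x: "?h 1 (free_gen X')" and y: "?h 1 (free_gen Y')" and z: "?h (- 1) (free_gen Z')"
    using homogeneous_gen[of sigma_degree] by (metis sigma_degree.simps)+
  have xs: "?h (- 1) (star ?F (free_gen X'))" and ys: "?h (- 1) (star ?F (free_gen Y'))"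
    and zs: "?h 1 (star ?F (free_gen Z'))"
    using homogeneous_star[OF x] homogeneous_star[OF y] homogeneous_star[OF z] by simp_all
  have yz: "?h 0 (free_gen Y' \<otimes>\<^bsub>?F\<^esub> free_gen Z')"
    using homogeneous_mult[OF y z] by simp
  have prod: "?h 0 (list_prod ?F
      (map (\<lambda>p. \<one>\<^bsub>?F\<^esub> - c p \<odot>\<^bsub>?F\<^esub> (free_gen Y' \<otimes>\<^bsub>?F\<^esub> free_gen Z')) ps))" for c :: "nat \<Rightarrow> complex" and ps
    by (rule homogeneous_list_prod)
      (auto intro!: homogeneous_diff homogeneous_one homogeneous_smult yz)
  have zz: "?h (- 2) (free_gen Z' \<otimes>\<^bsub>?F\<^esub> free_gen Z')"
    using homogeneous_mult[OF z z] by simp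
  note products = homogeneous_mult[OF z zs] homogeneous_mult[OF zs z]
    homogeneous_mult[OF z x] homogeneous_mult[OF x z] homogeneous_mult[OF z xs] homogeneous_mult[OF xs z]
    homogeneous_mult[OF z y] homogeneous_mult[OF y z] homogeneous_mult[OF z ys] homogeneous_mult[OF ys z]
    homogeneous_mult[OF x y] homogeneous_smult[OF homogeneous_mult[OF y x]]
    homogeneous_mult[OF x ys] homogeneous_smult[OF homogeneous_mult[OF ys x]]
    homogeneous_mult[OF y ys] homogeneous_mult[OF ys y] homogeneous_mult[OF y zz]
    homogeneous_mult[OF x xs] homogeneous_mult[OF xs x]
  show ?thesis
    using assms unfolding sigma_rels_def Let_def insert_iff prod.inject empty_iff
    by (elim disjE conjE FalseE; hypsubst; intro exI conjI)
      (rule products[simplified] ys homogeneous_one prod)+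
qed

theorem proposition4p10:
  fixes q :: real and l :: nat
  assumes "0 < q" and "q < 1" and "odd l"
  shows "trivial_comodule_algebra (O_Sigma3 q l) OU1 (Omega q l)"
proof -
  let ?R = "sigma_rels q l"
  interpret graded_presentation ?R sigma_degree
    by (rule graded_presentation.intro) (rule sigma_rels_homogeneous)
  let ?z = "free_gen Z'" and ?F = "free_star_alg :: (sigma_gen letter list \<Rightarrow>\<^sub>0 complex) star_alg"
  have z: "homogeneous sigma_degree (- 1) ?z"
    using homogeneous_gen[of sigma_degree Z'] by simp
  note zs = homogeneous_star[OF z]
  note \<pi> = presented_class_alg_hom[of ?R]
  \<comment> \<open>Unitarity of \<open>z'\<close> makes \<open>z'\<^sup>*\<close> and \<open>z'\<close> mutually inverse; their degrees are \<open>1\<close> and \<open>-1\<close>.\<close>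
  have rels: "(?z \<otimes>\<^bsub>?F\<^esub> star ?F ?z, \<one>\<^bsub>?F\<^esub>) \<in> ?R" "(star ?F ?z \<otimes>\<^bsub>?F\<^esub> ?z, \<one>\<^bsub>?F\<^esub>) \<in> ?R"
    by (simp_all add: sigma_rels_def Let_def)
  show ?thesis
    unfolding O_Sigma3_def Omega_def
  proof (rule trivial_comodule_algebraI[OF graded_comodule_algebra])
    show "presented_class ?R (star ?F ?z) \<otimes>\<^bsub>presented_alg ?R\<^esub> presented_class ?R ?z = \<one>\<^bsub>presented_alg ?R\<^esub>"
      "presented_class ?R ?z \<otimes>\<^bsub>presented_alg ?R\<^esub> presented_class ?R (star ?F ?z) = \<one>\<^bsub>presented_alg ?R\<^esub>"
      using presented_class_rel[OF rels(1)] presented_class_rel[OF rels(2)]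
      by (simp_all add: alg_hom_mult[OF \<pi>] alg_hom_one[OF \<pi>] carrier_free_star_alg)
  qed (use graded_coaction_homogeneous[OF z] graded_coaction_homogeneous[OF zs] in
      \<open>simp_all add: carrier_presented_alg\<close>)
qed

end
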